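(* Let $d=2$, let $\nu>0$, and let $\{Y_t(\mathbf{s}) : \mathbf{s}\in\mathbb{R}^2,\ t\in\mathbb{Z}\}$ be a zero-mean, second-order spatially and temporally stationary process with finite variance and spatio-temporal spectral density $f_Y(\underline{\lambda},\omega)$, $\underline{\lambda}=(\lambda_1,\lambda_2)\in\mathbb{R}^2$, $\omega\in[-\pi,\pi]$. Let $J_{\mathbf{s}}(\omega)$ be the discrete Fourier transform of the data $\{Y_t(\mathbf{s}) : t=1,\dots,n\}$ at location $\mathbf{s}=(s_1,s_2)$, and let $J_{\mathbf{s},e}(\omega)$ be the discrete Fourier transform of a space-time white noise $e_t(\mathbf{s})$ with variance parameter $\sigma_e^2$. Suppose that $\{J_{\mathbf{s}}(\omega)\}$ satisfies $$\left[\frac{\partial^2}{\partial s_1^2}+\frac{\partial^2}{\partial s_2^2}-|c(\omega)|^2\right]^{\nu}J_{\mathbf{s}}(\omega)=J_{\mathbf{s},e}(\omega)$$ (in the spectral sense specified in the context). Then the second-order spectral density of $\{Y_t(\mathbf{s})\}$ is $$f_Y(\underline{\lambda},\omega)=\frac{\sigma_e^2}{(2\pi)^2\left(\lambda_1^2+\lambda_2^2+|c(\omega)|^2\right)^{2\nu}}.$$ If moreover the stationary spatio-temporal process is isotropic, then the covariance function $g_{\|\mathbf{h}\|}(\omega)=\mathrm{Cov}(J_{\mathbf{s}}(\omega),J_{\mathbf{s}+\mathbf{h}}(\omega))$ (understood asymptotically, as specified in the context) between the discrete Fourier transforms is, for $\mathbf{h}=(h_1,h_2)\ne\mathbf{0}$,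 $$g_{\|\mathbf{h}\|}(\omega)=\frac{\sigma_e^2}{2\pi}\left(\frac{\|\mathbf{h}\|}{2|c(\omega)|}\right)^{2\nu-1}\frac{K_{2\nu-1}\left(|c(\omega)|\,\|\mathbf{h}\|\right)}{\Gamma(2\nu)},$$ where $\|\mathbf{h}\|=(h_1^2+h_2^2)^{1/2}$ and $K_\mu$ is the modified Bessel function of the second kind of order $\mu$. (Identities are for almost every $(\underline{\lambda},\omega)$, respectively almost every $\omega$.)
   Context: Spectral representation: $Y_t(\mathbf{s})=\int_{\mathbb{R}^d}\int_{-\pi}^{\pi}e^{i(\mathbf{s}\cdot\underline{\lambda}+t\omega)}\,dZ_Y(\underline{\lambda},\omega)$, where $Z_Y$ is a zero-mean complex process with orthogonal increments and $E|dZ_Y(\underline{\lambda},\omega)|^2=f_Y(\underline{\lambda},\omega)\,d\underline{\lambda}\,d\omega$. The covariance function is $c(\mathbf{h},u)=\mathrm{Cov}[Y_t(\mathbf{s}),Y_{t+u}(\mathbf{s}+\mathbf{h})]=\int_{\mathbb{R}^d}\int_{-\pi}^{\pi}e^{i(\mathbf{h}\cdot\underline{\lambda}+u\omega)}f_Y(\underline{\lambda},\omega)\,d\omega\,d\underline{\lambda}$. Finite variance means $f_Y$ is integrable on $\mathbb{R}^d\times[-\pi,\pi]$. The process is isotropic if $c(\mathbf{h},u)$ depends on $\mathbf{h}$ only through the Euclidean norm $\|\mathbf{h}\|$. Discrete Fourier transform: $J_{\mathbf{s}}(\omega)=\frac{1}{\sqrt{2\pi n}}\sum_{t=1}^nY_t(\mathbf{s})e^{-it\omega}$,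 and $J_{\mathbf{s},e}(\omega)$ is defined in the same way from $e_t(\mathbf{s})$. Throughout, $J_{\mathbf{s}}(\omega)$ and $J_{\mathbf{s},e}(\omega)$ are identified with their large-$n$ spectral representations $J_{\mathbf{s}}(\omega)=\int_{\mathbb{R}^d}e^{i\mathbf{s}\cdot\underline{\lambda}}\sqrt{n/2\pi}\,dZ_Y(\underline{\lambda},\omega)$ and $J_{\mathbf{s},e}(\omega)=\int_{\mathbb{R}^d}e^{i\mathbf{s}\cdot\underline{\lambda}}\sqrt{n/2\pi}\,dZ_e(\underline{\lambda},\omega)$ (integration over the wave number $\underline{\lambda}$ only), where $Z_e$ is the zero-mean orthogonal-increment process of the white noise, with constant spectral density normalized by $E|dZ_e(\underline{\lambda},\omega)|^2=\frac{\sigma_e^2}{(2\pi)^d}\,d\underline{\lambda}\,d\omega$. Meaning of the equation: the operator $\left[\sum_{j}\partial^2/\partial s_j^2-|c(\omega)|^2\right]^{\nu}$ acts under the integral as the Fourier multiplier $e^{i\mathbf{s}\cdot\underline{\lambda}}\mapsto\left(-\|\underline{\lambda}\|^2-|c(\omega)|^2\right)^{\nu}e^{i\mathbf{s}\cdot\underline{\lambda}}$ (a fixed branch of the power), and the equation is an equality of the resulting spectral increments. Here $c(\omega)$ is a (measurable) function of the temporal frequency with $|c(\omega)|>0$; it is unrelated to the covariance function $c(\mathbf{h},u)$. Covariance of the transforms: $\mathrm{Cov}(J_{\mathbf{s}}(\omega),J_{\mathbf{s}+\mathbf{h}}(\omega))$ is understood as its large-$n$ value, the cross spectrum $g_{\|\mathbf{h}\|}(\omega)$,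 i.e. the function of $\omega$ whose Fourier coefficients are the covariances $c(\mathbf{h},u)$, formally $\frac1{2\pi}\sum_{u}c(\|\mathbf{h}\|,u)e^{-iu\omega}$; equivalently $g_{\|\mathbf{h}\|}(\omega)=\int_{\mathbb{R}^d}e^{i\mathbf{h}\cdot\underline{\lambda}}f_Y(\underline{\lambda},\omega)\,d\underline{\lambda}$. *)

theory Defs
  imports "HOL-Probability.Probability"
begin

section \<open>Second-order properties of space-time processes\<close>

text \<open>
  Processes are complex valued, which includes the real-valued ones. The complex conjugate is
  put on the first argument of the covariance: with the representation
  \<open>Y t s = \<integral> exp (i (s \<bullet> l + t w)) dZ (l, w)\<close> this gives
  \<open>Cov (Y t s) (Y (t + u) (s + h)) = \<integral> exp (i (h \<bullet> l + u w)) f (l, w) d(l, w)\<close>.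
\<close>

definition square_integrable :: "'w measure \<Rightarrow> ('w \<Rightarrow> complex) \<Rightarrow> bool" where
  "square_integrable P X \<longleftrightarrow>
     X \<in> borel_measurable P \<and> integrable P (\<lambda>x. (cmod (X x))\<^sup>2)"

definition covariance :: "'w measure \<Rightarrow> ('w \<Rightarrow> complex) \<Rightarrow> ('w \<Rightarrow> complex) \<Rightarrow> complex" where
  "covariance P X X' =
     (\<integral>x. cnj (X x - (\<integral>y. X y \<partial>P)) * (X' x - (\<integral>y. X' y \<partial>P)) \<partial>P)"

definition autocov ::
    "'w measure \<Rightarrow> (int \<Rightarrow> real^2 \<Rightarrow> 'w \<Rightarrow> complex) \<Rightarrow> real^2 \<Rightarrow> int \<Rightarrow> complex" where
  "autocov P Y h u = covariance P (Y 0 0) (Y u h)"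

definition zero_mean_stationary ::
    "'w measure \<Rightarrow> (int \<Rightarrow> real^2 \<Rightarrow> 'w \<Rightarrow> complex) \<Rightarrow> bool" where
  "zero_mean_stationary P Y \<longleftrightarrow>
     (\<forall>t s. square_integrable P (Y t s) \<and> (\<integral>x. Y t s x \<partial>P) = 0) \<and>
     (\<forall>t s u h. covariance P (Y t s) (Y (t + u) (s + h)) = autocov P Y h u)"

definition isotropic :: "'w measure \<Rightarrow> (int \<Rightarrow> real^2 \<Rightarrow> 'w \<Rightarrow> complex) \<Rightarrow> bool" where
  "isotropic P Y \<longleftrightarrow>
     (\<forall>h h' u. norm h = norm h' \<longrightarrow> autocov P Y h u = autocov P Y h' u)"


section \<open>Orthogonal increments and stochastic integrals\<close>

text \<open>
  \<open>Z A\<close> is the increment of the process over the set \<open>A\<close>, and \<open>M\<close> is the control measure: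
  \<open>E |dZ|\<^sup>2 = dM\<close>. Only sets of finite control measure are constrained. Countable additivity in
  mean square follows from the other conditions.
\<close>

definition orthogonal_increments ::
    "'w measure \<Rightarrow> 'a measure \<Rightarrow> ('a set \<Rightarrow> 'w \<Rightarrow> complex) \<Rightarrow> bool" where
  "orthogonal_increments P M Z \<longleftrightarrow>
     (\<forall>A\<in>sets M. emeasure M A < \<infinity> \<longrightarrow>
        square_integrable P (Z A) \<and> (\<integral>x. Z A x \<partial>P) = 0 \<and>
        (\<integral>x. (cmod (Z A x))\<^sup>2 \<partial>P) = measure M A) \<and>
     (\<forall>A\<in>sets M. \<forall>B\<in>sets M.
        emeasure M A < \<infinity> \<longrightarrow> emeasure M B < \<infinity> \<longrightarrow> A \<inter> B = {} \<longrightarrow>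
        (AE x in P. Z (A \<union> B) x = Z A x + Z B x) \<and>
        (\<integral>x. Z A x * cnj (Z B x) \<partial>P) = 0)"

definition simple_stoch_integral ::
    "'a measure \<Rightarrow> ('a set \<Rightarrow> 'w \<Rightarrow> complex) \<Rightarrow> ('a \<Rightarrow> complex) \<Rightarrow> 'w \<Rightarrow> complex" where
  "simple_stoch_integral M Z \<phi> x =
     (\<Sum>y\<in>\<phi> ` space M. y * Z {a \<in> space M. \<phi> a = y} x)"

text \<open>
  The usual \<open>L\<^sup>2\<close> extension: \<open>X\<close> is a version of \<open>\<integral> \<phi> dZ\<close> if some simple functions of finite
  support measure converge to \<open>\<phi>\<close> in \<open>L\<^sup>2(M)\<close> while their integrals converge to \<open>X\<close> in
  \<open>L\<^sup>2(P)\<close>. This forces \<open>\<phi> \<in> L\<^sup>2(M)\<close>. In the integral of a simple function, the summand for the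
  value \<open>0\<close>, whose level set may have infinite measure, vanishes. For orthogonal increments, \<open>X\<close> is determined up to almost sure equality, and
  anything almost surely equal to \<open>X\<close> is again a version.
\<close>

definition has_stoch_integral ::
    "'w measure \<Rightarrow> 'a measure \<Rightarrow> ('a set \<Rightarrow> 'w \<Rightarrow> complex) \<Rightarrow> ('a \<Rightarrow> complex) \<Rightarrow>
     ('w \<Rightarrow> complex) \<Rightarrow> bool" where
  "has_stoch_integral P M Z \<phi> X \<longleftrightarrow>
     \<phi> \<in> borel_measurable M \<and> X \<in> borel_measurable P \<and>
     (\<exists>S. (\<forall>k. simple_function M (S k) \<and> emeasure M {a \<in> space M. S k a \<noteq> 0} < \<infinity>) \<and>
        (\<lambda>k. \<integral>\<^sup>+a. ennreal ((cmod (S k a - \<phi> a))\<^sup>2) \<partial>M) \<longlonglongrightarrow> 0 \<and>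
        (\<lambda>k. \<integral>\<^sup>+x. ennreal ((cmod (simple_stoch_integral M Z (S k) x - X x))\<^sup>2) \<partial>P)
          \<longlonglongrightarrow> 0)"


section \<open>Spectral densities and spectral representations\<close>

definition freq_space :: "((real^2) \<times> real) measure" where
  "freq_space = restrict_space lborel (UNIV \<times> {-pi..pi})"

definition spectral_density ::
    "'w measure \<Rightarrow> (int \<Rightarrow> real^2 \<Rightarrow> 'w \<Rightarrow> complex) \<Rightarrow> (real^2 \<Rightarrow> real \<Rightarrow> real) \<Rightarrow> bool" where
  "spectral_density P Y f \<longleftrightarrow>
     (\<forall>l. \<forall>w\<in>{-pi..pi}. 0 \<le> f l w) \<and>
     integrable freq_space (\<lambda>(l, w). f l w) \<and>
     (\<forall>h u. autocov P Y h u =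
        (\<integral>(l, w). cis (h \<bullet> l + of_int u * w) * complex_of_real (f l w) \<partial>freq_space))"

definition spectral_control ::
    "(real^2 \<Rightarrow> real \<Rightarrow> real) \<Rightarrow> ((real^2) \<times> real) measure" where
  "spectral_control f = density freq_space (\<lambda>(l, w). ennreal (f l w))"

definition spectral_representation ::
    "'w measure \<Rightarrow> (int \<Rightarrow> real^2 \<Rightarrow> 'w \<Rightarrow> complex) \<Rightarrow> (real^2 \<Rightarrow> real \<Rightarrow> real) \<Rightarrow>
     (((real^2) \<times> real) set \<Rightarrow> 'w \<Rightarrow> complex) \<Rightarrow> bool" where
  "spectral_representation P Y f Z \<longleftrightarrow>
     orthogonal_increments P (spectral_control f) Z \<and>
     (\<forall>t s. has_stoch_integral P (spectral_control f) Z
        (\<lambda>(l, w). cis (s \<bullet> l + of_int t * w)) (Y t s))"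

text \<open>
  White noise in continuous space has no pointwise values; it is given by its orthogonal
  increments, with constant spectral density \<open>\<sigma>\<^sup>2 / (2 \<pi>)\<^sup>2\<close> over all wave numbers in the plane.
\<close>

abbreviation white_noise_density :: "real \<Rightarrow> real^2 \<Rightarrow> real \<Rightarrow> real" where
  "white_noise_density \<sigma> \<equiv> (\<lambda>l w. \<sigma>\<^sup>2 / (2 * pi)\<^sup>2)"

definition white_noise_increments ::
    "'w measure \<Rightarrow> real \<Rightarrow> (((real^2) \<times> real) set \<Rightarrow> 'w \<Rightarrow> complex) \<Rightarrow> bool" where
  "white_noise_increments P \<sigma> Z \<longleftrightarrow>
     orthogonal_increments P (spectral_control (white_noise_density \<sigma>)) Z"


section \<open>The equation for the discrete Fourier transforms\<close>

text \<open>
  The discrete Fourier transform at location \<open>s\<close> of a sample of size \<open>n\<close> is taken in its large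
  sample form \<open>J s w = \<integral> exp (i (s \<bullet> l)) sqrt (n / (2 \<pi>)) dZ (l, w)\<close>, where only \<open>l\<close> is
  integrated out, so that \<open>J s w\<close> is still a differential in \<open>w\<close>. Its spectral increments
  \<open>exp (i (s \<bullet> l)) sqrt (n / (2 \<pi>)) dZ (l, w)\<close> are random variables once accumulated over a set
  \<open>A\<close> of pairs \<open>(l, w)\<close>. A Fourier multiplier \<open>m\<close> acts on them by multiplication under the
  integral.
\<close>

definition has_dft_increment ::
    "'w measure \<Rightarrow> (real^2 \<Rightarrow> real \<Rightarrow> real) \<Rightarrow> (((real^2) \<times> real) set \<Rightarrow> 'w \<Rightarrow> complex) \<Rightarrow> nat \<Rightarrow>
     (real^2 \<Rightarrow> real \<Rightarrow> complex) \<Rightarrow> real^2 \<Rightarrow> ((real^2) \<times> real) set \<Rightarrow> ('w \<Rightarrow> complex) \<Rightarrow> bool" where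
  "has_dft_increment P f Z n m s A X \<longleftrightarrow>
     has_stoch_integral P (spectral_control f) Z
       (\<lambda>(l, w). indicator A (l, w) *
          (m l w * cis (s \<bullet> l) * complex_of_real (sqrt (real n / (2 * pi))))) X"

text \<open>The integer \<open>k\<close> selects the branch of the power; \<open>k = 0\<close> is the principal one.\<close>

definition power_branch :: "int \<Rightarrow> complex \<Rightarrow> real \<Rightarrow> complex" where
  "power_branch k z \<nu> = exp (complex_of_real \<nu> * (Ln z + 2 * of_int k * of_real pi * \<i>))"

definition operator_symbol ::
    "int \<Rightarrow> real \<Rightarrow> (real \<Rightarrow> complex) \<Rightarrow> real^2 \<Rightarrow> real \<Rightarrow> complex" where
  "operator_symbol k \<nu> c l w =
     power_branch k (complex_of_real (- (norm l)\<^sup>2 - (cmod (c w))\<^sup>2)) \<nu>"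

text \<open>
  Equality of the spectral increments of both sides, at every location and over every frequency
  set of finite Lebesgue measure. The common version \<open>X\<close> expresses almost sure equality of the
  two stochastic integrals.
\<close>

definition satisfies_dft_equation ::
    "'w measure \<Rightarrow> (real^2 \<Rightarrow> real \<Rightarrow> real) \<Rightarrow> (((real^2) \<times> real) set \<Rightarrow> 'w \<Rightarrow> complex) \<Rightarrow>
     real \<Rightarrow> (((real^2) \<times> real) set \<Rightarrow> 'w \<Rightarrow> complex) \<Rightarrow> nat \<Rightarrow> int \<Rightarrow> real \<Rightarrow> (real \<Rightarrow> complex) \<Rightarrow>
     bool" where
  "satisfies_dft_equation P f Z\<^sub>Y \<sigma> Z\<^sub>e n k \<nu> c \<longleftrightarrow>
     (\<forall>s. \<forall>A\<in>sets freq_space. emeasure freq_space A < \<infinity> \<longrightarrow>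
        (\<exists>X. has_dft_increment P f Z\<^sub>Y n (operator_symbol k \<nu> c) s A X \<and>
             has_dft_increment P (white_noise_density \<sigma>) Z\<^sub>e n (\<lambda>l w. 1) s A X))"


section \<open>Covariance of the transforms\<close>

text \<open>
  The large sample covariance of the transforms at two locations with difference \<open>h\<close>: the
  function of \<open>w\<close> whose Fourier coefficients are the covariances \<open>autocov P Y h u\<close>, formally
  \<open>(1 / (2 \<pi>)) \<Sum>u. autocov P Y h u * exp (- i u w)\<close>. The coefficients determine it up to a
  null set.
\<close>

definition cross_spectrum ::
    "'w measure \<Rightarrow> (int \<Rightarrow> real^2 \<Rightarrow> 'w \<Rightarrow> complex) \<Rightarrow> real^2 \<Rightarrow> (real \<Rightarrow> complex) \<Rightarrow> bool" where
  "cross_spectrum P Y h g \<longleftrightarrow>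
     set_integrable lborel {-pi..pi} g \<and>
     (\<forall>u. autocov P Y h u = (LINT w:{-pi..pi}|lborel. cis (of_int u * w) * g w))"

text \<open>
  Modified Bessel function of the second kind, for real order and positive argument, by the
  classical integral formula (DLMF 10.32.9).
\<close>

definition Bessel_K :: "real \<Rightarrow> real \<Rightarrow> real" where
  "Bessel_K \<mu> z = (LINT t:{0..}|lborel. exp (- z * cosh t) * cosh (\<mu> * t))"

end

theory Submission
  imports Defs
begin

text \<open>
  The stochastic integral is an isometry, so equality of the spectral increments of both sides
  over all frequency sets forces \<open>|m|\<^sup>2 f = \<sigma>\<^sup>2 / (2 \<pi>)\<^sup>2\<close> almost everywhere, where \<open>m\<close> is the
  symbol of the operator; its modulus does not depend on the branch of the power. The density is
  therefore radial in the wave number, and the cross spectrum is its Fourier transform in the wave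
  number. Writing \<open>(|l|\<^sup>2 + a\<^sup>2)\<close> to the power \<open>-p\<close> as a Gamma integral of Gaussians and exchanging
  integrals leaves \<open>\<integral> t\<^sup>p\<^sup>-\<^sup>2 exp (- t a\<^sup>2 - r\<^sup>2 / (4 t)) dt\<close>, a Bessel function. No range of \<open>p\<close>
  has to be imposed: if \<open>\<sigma> \<noteq> 0\<close>, integrability of the density supplies the integrability that
  Fubini's theorem needs. A cross spectrum is unique because an integrable function on
  \<open>[-\<pi>, \<pi>]\<close> with vanishing Fourier coefficients vanishes almost everywhere.
\<close>

section \<open>Isometry of the stochastic integral\<close>

lemma integrable_mult_cnj:
  assumes "square_integrable P X" "square_integrable P Y"
  shows "integrable P (\<lambda>x. X x * cnj (Y x))"
proof (rule Bochner_Integration.integrable_bound)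
  show "integrable P (\<lambda>x. (cmod (X x))\<^sup>2 + (cmod (Y x))\<^sup>2)"
    using assms by (auto simp: square_integrable_def)
  have [measurable]: "X \<in> borel_measurable P" "Y \<in> borel_measurable P"
    using assms by (auto simp: square_integrable_def)
  have [measurable]: "cnj \<in> borel_measurable borel"
    by (intro borel_measurable_continuous_onI continuous_intros)
  show "(\<lambda>x. X x * cnj (Y x)) \<in> borel_measurable P"
    by measurable
  show "AE x in P. norm (X x * cnj (Y x)) \<le> norm ((cmod (X x))\<^sup>2 + (cmod (Y x))\<^sup>2)"
  proof (rule AE_I2)
    fix x
    have "0 \<le> (cmod (X x) - cmod (Y x))\<^sup>2" by simp
    moreover have "0 \<le> cmod (X x) * cmod (Y x)" by simp
    ultimately have "cmod (X x) * cmod (Y x) \<le> (cmod (X x))\<^sup>2 + (cmod (Y x))\<^sup>2"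
      unfolding power2_diff by linarith
    then show "norm (X x * cnj (Y x)) \<le> norm ((cmod (X x))\<^sup>2 + (cmod (Y x))\<^sup>2)"
      by (simp add: norm_mult)
  qed
qed

text \<open>Expanding the squared modulus gives a double sum over pairs of values. Level sets of
  distinct values are disjoint, so orthogonality of the increments leaves only the diagonal, where
  the second moment is the control measure. The value 0 is removed first: its level set may have
  infinite measure, and nothing is known about the increment there.\<close>

lemma simple_stoch_integral_isometry:
  fixes S :: "'a \<Rightarrow> complex"
  assumes Z: "orthogonal_increments P M Z" and S: "simple_function M S"
    and fin: "emeasure M {a \<in> space M. S a \<noteq> 0} < \<infinity>"
  shows "(\<integral>\<^sup>+a. ennreal ((cmod (S a))\<^sup>2) \<partial>M) =
         (\<integral>\<^sup>+x. ennreal ((cmod (simple_stoch_integral M Z S x))\<^sup>2) \<partial>P)"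
proof -
  define V where "V = S ` space M - {0}"
  define A where "A y = {a \<in> space M. S a = y}" for y
  have finV [simp]: "finite V"
    using S by (auto simp: V_def simple_function_def)
  have A_sets [measurable]: "A y \<in> sets M" for y
  proof -
    have "S -` {y} \<inter> space M \<in> sets M"
      using S by (rule simple_functionD)
    moreover have "A y = S -` {y} \<inter> space M"
      by (auto simp: A_def)
    ultimately show ?thesis by simp
  qed
  have A_fin: "emeasure M (A y) < \<infinity>" if "y \<in> V" for y
  proof -
    have "S -` (- {0}) \<inter> space M \<in> sets M"
      using S by (rule simple_functionD)
    moreover have "S -` (- {0}) \<inter> space M = {a \<in> space M. S a \<noteq> 0}"
      by auto
    ultimately have "emeasure M (A y) \<le> emeasure M {a \<in> space M. S a \<noteq> 0}"
      using that by (intro emeasure_mono) (auto simp: A_def V_def)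
    with fin show ?thesis by (simp add: le_less_trans)
  qed
  have sq: "square_integrable P (Z (A y))" if "y \<in> V" for y
    using Z A_fin[OF that] A_sets unfolding orthogonal_increments_def by blast
  have diag: "(\<integral>x. Z (A y) x * cnj (Z (A y) x) \<partial>P) = of_real (measure M (A y))" if "y \<in> V" for y
  proof -
    have "(\<integral>x. (cmod (Z (A y) x))\<^sup>2 \<partial>P) = measure M (A y)"
      using Z A_fin[OF that] A_sets unfolding orthogonal_increments_def by blast
    then show ?thesis
      by (simp only: complex_norm_square[symmetric] integral_complex_of_real)
  qed
  have offdiag: "(\<integral>x. Z (A y) x * cnj (Z (A z) x) \<partial>P) = 0" if "y \<in> V" "z \<in> V" "y \<noteq> z" for y z
  proof -
    have "A y \<inter> A z = {}" using that by (auto simp: A_def)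
    then show ?thesis
      using Z A_fin[OF that(1)] A_fin[OF that(2)] A_sets unfolding orthogonal_increments_def by blast
  qed
  define I where "I x = (\<Sum>y\<in>V. y * Z (A y) x)" for x
  have I: "simple_stoch_integral M Z S x = I x" for x
    unfolding simple_stoch_integral_def I_def A_def[symmetric]
    using S by (intro sum.mono_neutral_right) (auto simp: V_def simple_function_def)
  have II: "complex_of_real ((cmod (I x))\<^sup>2) =
      (\<Sum>y\<in>V. \<Sum>z\<in>V. y * cnj z * (Z (A y) x * cnj (Z (A z) x)))" for x
    unfolding complex_norm_square I_def cnj_sum sum_product by (simp add: mult_ac)
  have int: "integrable P (\<lambda>x. complex_of_real ((cmod (I x))\<^sup>2))"
    unfolding II
    by (intro Bochner_Integration.integrable_sum integrable_mult_right integrable_mult_cnj sq)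
  have "(\<integral>x. complex_of_real ((cmod (I x))\<^sup>2) \<partial>P) =
      (\<Sum>y\<in>V. \<Sum>z\<in>V. y * cnj z * (\<integral>x. Z (A y) x * cnj (Z (A z) x) \<partial>P))"
    unfolding II by (simp add: integrable_mult_cnj sq)
  also have "\<dots> = (\<Sum>y\<in>V. \<Sum>z\<in>V. if y = z then y * cnj z * of_real (measure M (A y)) else 0)"
    by (intro sum.cong refl) (auto simp: diag offdiag)
  also have "\<dots> = (\<Sum>y\<in>V. of_real ((cmod y)\<^sup>2 * measure M (A y)))"
    by (simp add: complex_norm_square[symmetric] mult.assoc del: of_real_power)
  also have "\<dots> = of_real (\<Sum>y\<in>V. (cmod y)\<^sup>2 * measure M (A y))"
    by simp
  finally have EI: "(\<integral>x. (cmod (I x))\<^sup>2 \<partial>P) = (\<Sum>y\<in>V. (cmod y)\<^sup>2 * measure M (A y))"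
    by (simp only: integral_complex_of_real of_real_eq_iff)
  have "(\<integral>\<^sup>+x. ennreal ((cmod (I x))\<^sup>2) \<partial>P) = ennreal (\<integral>x. (cmod (I x))\<^sup>2 \<partial>P)"
    using integrable_Re[OF int] by (intro nn_integral_eq_integral) (auto simp del: of_real_power)
  also have "\<dots> = (\<Sum>y\<in>V. ennreal ((cmod y)\<^sup>2) * emeasure M (A y))"
    unfolding EI using A_fin
    by (auto simp: sum_ennreal[symmetric] ennreal_mult emeasure_eq_ennreal_measure less_top intro!: sum.cong)
  also have "\<dots> = (\<integral>\<^sup>+a. (\<Sum>y\<in>V. ennreal ((cmod y)\<^sup>2) * indicator (A y) a) \<partial>M)"
    by (subst nn_integral_sum) (auto simp: nn_integral_cmult_indicator)
  also have "\<dots> = (\<integral>\<^sup>+a. ennreal ((cmod (S a))\<^sup>2) \<partial>M)"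
  proof (rule nn_integral_cong)
    fix a assume a: "a \<in> space M"
    have "(\<Sum>y\<in>V. ennreal ((cmod y)\<^sup>2) * indicator (A y) a) =
        (\<Sum>y\<in>V. if y = S a then ennreal ((cmod (S a))\<^sup>2) else 0)"
      using a by (intro sum.cong) (auto simp: A_def)
    also have "\<dots> = ennreal ((cmod (S a))\<^sup>2)"
      using a by (simp add: sum.delta) (auto simp: V_def)
    finally show "(\<Sum>y\<in>V. ennreal ((cmod y)\<^sup>2) * indicator (A y) a) = ennreal ((cmod (S a))\<^sup>2)" .
  qed
  finally show ?thesis by (simp add: I)
qed

text \<open>Young's inequality \<open>2 * x * y \<le> \<epsilon> * x\<^sup>2 + y\<^sup>2 /
  \<epsilon>\<close> applied to the triangle inequality. The weight keeps the factor of the main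
  term as close to 1 as desired, so that a limit argument can end with the exact constant 1.\<close>

lemma cmod_add_square_le:
  assumes "\<epsilon> > 0"
  shows "(cmod b)\<^sup>2 \<le> (1 + \<epsilon>) * (cmod a)\<^sup>2 + (1 + 1 / \<epsilon>) * (cmod (a - b))\<^sup>2"
proof -
  define x y where "x = cmod a" and "y = cmod (a - b)"
  have "cmod b \<le> x + y"
    unfolding x_def y_def by (metis norm_minus_commute norm_triangle_sub)
  then have "(cmod b)\<^sup>2 \<le> (x + y)\<^sup>2"
    by (intro power_mono) auto
  moreover have "0 \<le> (\<epsilon> * x - y)\<^sup>2 / \<epsilon>"
    using assms by simp
  then have "0 \<le> \<epsilon> * x\<^sup>2 - 2 * x * y + y\<^sup>2 / \<epsilon>"
    using assms by (simp add: power2_eq_square field_simps)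
  ultimately have "(cmod b)\<^sup>2 \<le> (1 + \<epsilon>) * x\<^sup>2 + (1 + 1 / \<epsilon>) * y\<^sup>2"
    by (simp add: power2_sum algebra_simps)
  then show ?thesis by (simp add: x_def y_def)
qed

lemma nn_integral_square_perturb:
  assumes "\<epsilon> > 0" and [measurable]: "f \<in> borel_measurable M" "g \<in> borel_measurable M"
  shows "(\<integral>\<^sup>+a. ennreal ((cmod (g a))\<^sup>2) \<partial>M) \<le>
    ennreal (1 + \<epsilon>) * (\<integral>\<^sup>+a. ennreal ((cmod (f a))\<^sup>2) \<partial>M) +
    ennreal (1 + 1 / \<epsilon>) * (\<integral>\<^sup>+a. ennreal ((cmod (f a - g a))\<^sup>2) \<partial>M)"
proof -
  have "(\<integral>\<^sup>+a. ennreal ((cmod (g a))\<^sup>2) \<partial>M) \<le>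
    (\<integral>\<^sup>+a. ennreal (1 + \<epsilon>) * ennreal ((cmod (f a))\<^sup>2) + ennreal (1 + 1 / \<epsilon>) * ennreal ((cmod (f a - g a))\<^sup>2) \<partial>M)"
    using assms(1) cmod_add_square_le[OF assms(1)]
    by (intro nn_integral_mono) (simp add: ennreal_mult[symmetric] ennreal_plus[symmetric] del: ennreal_plus)
  also have "\<dots> = ennreal (1 + \<epsilon>) * (\<integral>\<^sup>+a. ennreal ((cmod (f a))\<^sup>2) \<partial>M) +
    ennreal (1 + 1 / \<epsilon>) * (\<integral>\<^sup>+a. ennreal ((cmod (f a - g a))\<^sup>2) \<partial>M)"
    by (simp add: nn_integral_add nn_integral_cmult)
  finally show ?thesis .
qed

text \<open>For fixed \<epsilon> the error terms vanish as k grows; afterwards \<epsilon> tends to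
  0. Working with nonnegative extended integrals avoids showing beforehand that the limits are
  square integrable. The hypotheses are symmetric in the two sides, so one inequality is
  enough.\<close>

lemma nn_integral_square_le_of_isometric_limit:
  assumes [measurable]: "\<And>k. S k \<in> borel_measurable M" "\<phi> \<in> borel_measurable M"
      "\<And>k. T k \<in> borel_measurable P" "X \<in> borel_measurable P"
    and S: "(\<lambda>k. \<integral>\<^sup>+a. ennreal ((cmod (S k a - \<phi> a))\<^sup>2) \<partial>M) \<longlonglongrightarrow> 0"
    and T: "(\<lambda>k. \<integral>\<^sup>+a. ennreal ((cmod (T k a - X a))\<^sup>2) \<partial>P) \<longlonglongrightarrow> 0"
    and iso: "\<And>k. (\<integral>\<^sup>+a. ennreal ((cmod (S k a))\<^sup>2) \<partial>M) = (\<integral>\<^sup>+a. ennreal ((cmod (T k a))\<^sup>2) \<partial>P)"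
  shows "(\<integral>\<^sup>+a. ennreal ((cmod (\<phi> a))\<^sup>2) \<partial>M) \<le> (\<integral>\<^sup>+a. ennreal ((cmod (X a))\<^sup>2) \<partial>P)"
    (is "?L \<le> ?R")
proof -
  have le: "?L \<le> ennreal ((1 + \<epsilon>) * (1 + \<epsilon>)) * ?R" if "\<epsilon> > 0" for \<epsilon> :: real
  proof -
    let ?s = "\<lambda>k. \<integral>\<^sup>+a. ennreal ((cmod (S k a - \<phi> a))\<^sup>2) \<partial>M"
    let ?t = "\<lambda>k. \<integral>\<^sup>+a. ennreal ((cmod (X a - T k a))\<^sup>2) \<partial>P"
    \<comment> \<open>Two perturbations are chained, from \<open>S k\<close> to
      \<open>\<phi>\<close> and, across the isometry, from \<open>X\<close> to \<open>T k\<close>;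
      hence the factor \<open>1 + \<epsilon>\<close> appears twice.\<close>
    let ?B = "\<lambda>k. ennreal (1 + \<epsilon>) * (ennreal (1 + \<epsilon>) * ?R + ennreal (1 + 1 / \<epsilon>) * ?t k) + ennreal (1 + 1 / \<epsilon>) * ?s k"
    have "?L \<le> ?B k" for k
    proof -
      have "?L \<le> ennreal (1 + \<epsilon>) * (\<integral>\<^sup>+a. ennreal ((cmod (S k a))\<^sup>2) \<partial>M) + ennreal (1 + 1 / \<epsilon>) * ?s k"
        using that by (intro nn_integral_square_perturb) auto
      also have "(\<integral>\<^sup>+a. ennreal ((cmod (S k a))\<^sup>2) \<partial>M) \<le> ennreal (1 + \<epsilon>) * ?R + ennreal (1 + 1 / \<epsilon>) * ?t k"
        unfolding iso using that by (intro nn_integral_square_perturb) auto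
      finally show ?thesis by (simp add: mult_left_mono add_right_mono)
    qed
    moreover have "?B \<longlonglongrightarrow> ennreal (1 + \<epsilon>) * (ennreal (1 + \<epsilon>) * ?R + ennreal (1 + 1 / \<epsilon>) * 0) + ennreal (1 + 1 / \<epsilon>) * 0"
      using S T by (intro tendsto_add tendsto_const ennreal_tendsto_cmult) (auto simp: norm_minus_commute)
    ultimately have "?L \<le> ennreal (1 + \<epsilon>) * (ennreal (1 + \<epsilon>) * ?R + ennreal (1 + 1 / \<epsilon>) * 0) + ennreal (1 + 1 / \<epsilon>) * 0"
      by (intro LIMSEQ_le_const) auto
    then show ?thesis using that by (simp add: mult.assoc ennreal_mult)
  qed
  show ?thesis
  proof (cases "?R = \<infinity>")
    case False
    let ?c = "\<lambda>n. (1 + inverse (real (Suc n))) * (1 + inverse (real (Suc n)))"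
    have "?c \<longlonglongrightarrow> (1 + 0) * (1 + 0)"
      by (intro tendsto_intros LIMSEQ_inverse_real_of_nat)
    then have "(\<lambda>n. ennreal (?c n)) \<longlonglongrightarrow> ennreal 1"
      by (intro tendsto_ennrealI) simp
    with False have "(\<lambda>n. ennreal (?c n) * ?R) \<longlonglongrightarrow> ennreal 1 * ?R"
      by (intro tendsto_mult_ennreal tendsto_const) auto
    then have "(\<lambda>n. ennreal (?c n) * ?R) \<longlonglongrightarrow> ?R" by simp
    then show ?thesis
      by (rule LIMSEQ_le_const) (intro exI allI impI le; simp)
  qed simp
qed

lemma stoch_integral_isometry:
  assumes Z: "orthogonal_increments P M Z" and X: "has_stoch_integral P M Z \<phi> X"
  shows "(\<integral>\<^sup>+a. ennreal ((cmod (\<phi> a))\<^sup>2) \<partial>M) = (\<integral>\<^sup>+x. ennreal ((cmod (X x))\<^sup>2) \<partial>P)"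
proof -
  from X obtain S where [measurable]: "\<phi> \<in> borel_measurable M" "X \<in> borel_measurable P"
    and S: "\<And>k. simple_function M (S k)" "\<And>k. emeasure M {a \<in> space M. S k a \<noteq> 0} < \<infinity>"
    and lim: "(\<lambda>k. \<integral>\<^sup>+a. ennreal ((cmod (S k a - \<phi> a))\<^sup>2) \<partial>M) \<longlonglongrightarrow> 0"
      "(\<lambda>k. \<integral>\<^sup>+x. ennreal ((cmod (simple_stoch_integral M Z (S k) x - X x))\<^sup>2) \<partial>P) \<longlonglongrightarrow> 0"
    unfolding has_stoch_integral_def by blast
  have [measurable]: "S k \<in> borel_measurable M" for k
    using S(1) by (rule borel_measurable_simple_function)
  have meas [measurable]: "simple_stoch_integral M Z (S k) \<in> borel_measurable P" for k
  proof -
    \<comment> \<open>For y = 0 the level set may have infinite measure and its increment need not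
      be measurable; the factor y makes the summand zero. Every other level set lies in the support,
      which has finite measure.\<close>
    have "(\<lambda>x. y * Z {a \<in> space M. S k a = y} x) \<in> borel_measurable P" for y
    proof (cases "y = 0")
      case False
      have "{a \<in> space M. S k a = y} \<in> sets M" "{a \<in> space M. S k a \<noteq> 0} \<in> sets M"
        by measurable
      moreover from this False have "emeasure M {a \<in> space M. S k a = y} \<le> emeasure M {a \<in> space M. S k a \<noteq> 0}"
        by (intro emeasure_mono) auto
      ultimately have "Z {a \<in> space M. S k a = y} \<in> borel_measurable P"
        using Z S(2)[of k] unfolding orthogonal_increments_def square_integrable_def
        by (metis (no_types, lifting) le_less_trans)
      then show ?thesis by measurable
    qed simp
    then show ?thesis
      unfolding simple_stoch_integral_def[abs_def] by (intro borel_measurable_sum)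
  qed
  note iso = simple_stoch_integral_isometry[OF Z S]
  show ?thesis
    \<comment> \<open>The limit inequality is used twice, the second time with the roles of
      \<open>M\<close> and \<open>P\<close> exchanged.\<close>
    by (intro antisym nn_integral_square_le_of_isometric_limit[OF _ _ _ _ lim iso]
        nn_integral_square_le_of_isometric_limit[OF _ _ _ _ lim(2,1) iso[symmetric]]) measurable
qed

section \<open>Fourier transform of inverse powers\<close>

lemma measurable_cis [measurable]: "cis \<in> borel_measurable borel"
  by (intro borel_measurable_continuous_onI continuous_intros)

lemma measurable_cosh_real [measurable]: "(cosh :: real \<Rightarrow> real) \<in> borel_measurable borel"
  by (rule borel_measurable_continuous_onI) (rule continuous_on_cosh[OF continuous_on_id])

section \<open>Gaussian Fourier transforms\<close>

text \<open>A rescaling of the characteristic function of the standard normal distribution.\<close>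

lemma gaussian_fourier_real:
  fixes t h :: real
  assumes "t > 0"
  shows "integrable lborel (\<lambda>x. cis (h * x) * complex_of_real (exp (- t * x\<^sup>2)))" (is ?int)
    and "(\<integral>x. cis (h * x) * complex_of_real (exp (- t * x\<^sup>2)) \<partial>lborel) =
      complex_of_real (sqrt (pi / t) * exp (- h\<^sup>2 / (4 * t)))" (is ?eq)
proof -
  \<comment> \<open>The scale c is chosen so that
    \<open>(c * x)\<^sup>2 / 2 = t * x\<^sup>2\<close>, and s so that the phase
    \<open>s * (c * x)\<close> is again \<open>h * x\<close>. The value
    \<open>exp (- s\<^sup>2 / 2)\<close> then becomes
    \<open>exp (- h\<^sup>2 / (4 * t))\<close>.\<close>
  define c s where "c = sqrt (2 * t)" and "s = h / c"
  have c: "c > 0" "c\<^sup>2 = 2 * t" using assms by (auto simp: c_def)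
  have sc: "s * (c * x) = h * x" for x using c by (simp add: s_def)
  let ?f = "\<lambda>x. std_normal_density x *\<^sub>R iexp (s * x)"
  have f_sub: "?f (0 + c * x) = complex_of_real (1 / sqrt (2 * pi)) *
      (cis (h * x) * complex_of_real (exp (- t * x\<^sup>2)))" for x
  proof -
    have "std_normal_density (c * x) = 1 / sqrt (2 * pi) * exp (- t * x\<^sup>2)"
      using c by (simp add: std_normal_density_def power_mult_distrib)
    moreover have "iexp (s * (c * x)) = cis (h * x)"
      by (simp only: sc cis_conv_exp)
    ultimately show ?thesis
      unfolding add_0 scaleR_conv_of_real by simp
  qed
  have f_int: "integrable lborel ?f"
  proof (rule Bochner_Integration.integrable_bound)
    show "integrable lborel std_normal_density" by simp
  qed auto
  have "integrable lborel (\<lambda>x. ?f (0 + c * x))"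
    using f_int c by (intro lborel_integrable_real_affine) auto
  then have "integrable lborel (\<lambda>x. complex_of_real (sqrt (2 * pi)) * (complex_of_real (1 / sqrt (2 * pi)) *
      (cis (h * x) * complex_of_real (exp (- t * x\<^sup>2)))))"
    unfolding f_sub by (rule integrable_mult_right)
  moreover have "complex_of_real (sqrt (2 * pi)) * (complex_of_real (1 / sqrt (2 * pi)) * z) = z" for z
    by simp
  ultimately show ?int by (simp only:)
  have "(\<integral>x. ?f x \<partial>lborel) = char std_normal_distribution s"
    unfolding char_def by (subst integral_density) auto
  also have "\<dots> = complex_of_real (exp (- h\<^sup>2 / (4 * t)))"
    using c by (simp add: char_std_normal_distribution s_def power_divide)
  finally have "complex_of_real (exp (- h\<^sup>2 / (4 * t))) = c *\<^sub>R (\<integral>x. ?f (0 + c * x) \<partial>lborel)"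
    using lborel_integral_real_affine[of c ?f 0] c by simp
  also have "\<dots> = complex_of_real (c / sqrt (2 * pi)) *
      (\<integral>x. cis (h * x) * complex_of_real (exp (- t * x\<^sup>2)) \<partial>lborel)"
    unfolding f_sub by (simp add: scaleR_conv_of_real)
  finally have *: "complex_of_real (c / sqrt (2 * pi)) *
      (\<integral>x. cis (h * x) * complex_of_real (exp (- t * x\<^sup>2)) \<partial>lborel) = complex_of_real (exp (- h\<^sup>2 / (4 * t)))" ..
  have "sqrt (pi / t) * (c / sqrt (2 * pi)) = 1"
    using assms by (simp add: c_def real_sqrt_mult[symmetric] real_sqrt_divide[symmetric])
  then have "complex_of_real (sqrt (pi / t)) * complex_of_real (c / sqrt (2 * pi)) = 1"
    by (metis of_real_1 of_real_mult)
  then show ?eq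
    using arg_cong[OF *, of "\<lambda>z. complex_of_real (sqrt (pi / t)) * z"]
    by (simp only: mult.assoc[symmetric] of_real_mult) simp
qed

text \<open>Both the character and the Gaussian are products over the coordinates, and
  \<open>lborel\<close> is the image of the product of the one-dimensional measures, so the integral
  factors into one-dimensional ones.\<close>

lemma gaussian_fourier:
  fixes h :: "'a::euclidean_space"
  assumes "t > 0"
  shows "(\<integral>l. cis (h \<bullet> l) * complex_of_real (exp (- t * (norm l)\<^sup>2)) \<partial>lborel) =
    complex_of_real (sqrt (pi / t) ^ DIM('a) * exp (- (norm h)\<^sup>2 / (4 * t)))"
proof -
  define G where "G b x = cis ((h \<bullet> b) * x) * complex_of_real (exp (- t * x\<^sup>2))" for b x
  have cis_sum: "cis (\<Sum>b\<in>B. f b) = (\<Prod>b\<in>B. cis (f b))" if "finite B" for B :: "'a set" and f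
    using that by (induction B) (simp_all add: cis_mult[symmetric] del: cis_mult)
  have norm2: "(norm x)\<^sup>2 = (\<Sum>b\<in>Basis. (x \<bullet> b)\<^sup>2)" for x :: 'a
    by (subst power2_norm_eq_inner, subst euclidean_inner) (simp add: power2_eq_square)
  have G: "cis (h \<bullet> l) * complex_of_real (exp (- t * (norm l)\<^sup>2)) = (\<Prod>b\<in>Basis. G b (l \<bullet> b))" for l
    unfolding G_def norm2 prod.distrib
    by (subst euclidean_inner) (simp add: cis_sum exp_sum sum_distrib_left sum_negf[symmetric])
  interpret product_sigma_finite "\<lambda>b::'a. lborel :: real measure" ..
  have [measurable]: "G b \<in> borel_measurable borel" for b
    unfolding G_def[abs_def] by (intro borel_measurable_continuous_onI continuous_intros)
  have "(\<integral>l. cis (h \<bullet> l) * complex_of_real (exp (- t * (norm l)\<^sup>2)) \<partial>lborel) =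
      (\<integral>l. (\<Prod>b\<in>Basis. G b (l \<bullet> b)) \<partial>(lborel :: 'a measure))"
    by (simp only: G)
  also have "\<dots> = (\<integral>f. (\<Prod>b\<in>Basis. G b (f b)) \<partial>(\<Pi>\<^sub>M b\<in>(Basis::'a set). lborel))"
    by (subst lborel_def) (simp add: integral_distr lborel_eq_real[symmetric])
  also have "\<dots> = (\<Prod>b\<in>Basis. \<integral>x. G b x \<partial>lborel)"
    using gaussian_fourier_real(1)[OF assms] by (intro product_integral_prod) (auto simp: G_def[abs_def])
  also have "\<dots> = (\<Prod>b\<in>Basis. complex_of_real (sqrt (pi / t) * exp (- (h \<bullet> b)\<^sup>2 / (4 * t))))"
    unfolding G_def gaussian_fourier_real(2)[OF assms] ..
  also have "\<dots> = complex_of_real (\<Prod>b\<in>Basis. sqrt (pi / t) * exp (- (h \<bullet> b)\<^sup>2 / (4 * t)))"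
    by simp
  also have "(\<Prod>b\<in>Basis. sqrt (pi / t) * exp (- (h \<bullet> b)\<^sup>2 / (4 * t))) =
      sqrt (pi / t) ^ DIM('a) * exp (- (norm h)\<^sup>2 / (4 * t))"
    unfolding norm2 prod.distrib
    by (simp add: exp_sum[symmetric] sum_negf sum_divide_distrib)
  finally show ?thesis .
qed

section \<open>Gamma and Bessel integrals\<close>

text \<open>The substitution of \<open>A * t\<close> for t in Euler's integral. The extended
  nonnegative form yields finiteness and the value together.\<close>

lemma nn_integral_Gamma_scaled:
  fixes p A :: real
  assumes "p > 0" "A > 0"
  shows "(\<integral>\<^sup>+t. ennreal (indicator {0<..} t * (t powr (p - 1) * exp (- t * A))) \<partial>lborel) =
    ennreal (Gamma p * A powr (- p))"
proof -
  let ?f = "\<lambda>t. ennreal (indicator {0..} t * t powr (p - 1) / exp t)"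
  have "ennreal (Gamma p) = (\<integral>\<^sup>+t. ?f t \<partial>lborel)"
    by (rule Gamma_conv_nn_integral_real) fact
  also have "\<dots> = ennreal A * (\<integral>\<^sup>+t. ?f (0 + A * t) \<partial>lborel)"
    using assms by (subst nn_integral_real_affine[where c = A and t = 0]) auto
  \<comment> \<open>At t = 0 both integrands vanish because \<open>0 powr (p - 1)\<close> is 0, so
    the closed half line may be replaced by the open one.\<close>
  also have "(\<integral>\<^sup>+t. ?f (0 + A * t) \<partial>lborel) =
      (\<integral>\<^sup>+t. ennreal (A powr (p - 1)) * ennreal (indicator {0<..} t * (t powr (p - 1) * exp (- t * A))) \<partial>lborel)"
    using assms
    by (intro nn_integral_cong)
      (auto simp: ennreal_mult[symmetric] powr_mult exp_minus field_simps zero_le_mult_iff split: split_indicator)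
  also have "\<dots> = ennreal (A powr (p - 1)) *
      (\<integral>\<^sup>+t. ennreal (indicator {0<..} t * (t powr (p - 1) * exp (- t * A))) \<partial>lborel)"
    by (intro nn_integral_cmult) auto
  finally have "ennreal (Gamma p) = ennreal (A powr p) *
      (\<integral>\<^sup>+t. ennreal (indicator {0<..} t * (t powr (p - 1) * exp (- t * A))) \<partial>lborel)" (is "_ = _ * ?I")
    using assms by (simp add: mult.assoc[symmetric] ennreal_mult[symmetric] powr_diff)
  then have "ennreal (A powr (- p)) * ennreal (Gamma p) = ennreal (A powr (- p)) * ennreal (A powr p) * ?I"
    by (simp add: mult.assoc)
  also have "ennreal (A powr (- p)) * ennreal (A powr p) = 1"
    using assms by (simp add: ennreal_mult[symmetric] powr_add[symmetric])
  finally show ?thesis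
    using assms by (simp add: ennreal_mult[symmetric] Gamma_real_nonneg mult.commute)
qed

lemma Gamma_integral_scaled:
  fixes p A :: real
  assumes "p > 0" "A > 0"
  shows "integrable lborel (\<lambda>t. indicator {0<..} t * (t powr (p - 1) * exp (- t * A)))"
    and "(\<integral>t. indicator {0<..} t * (t powr (p - 1) * exp (- t * A)) \<partial>lborel) = Gamma p * A powr (- p)"
proof -
  show int: "integrable lborel (\<lambda>t. indicator {0<..} t * (t powr (p - 1) * exp (- t * A)))"
    using nn_integral_Gamma_scaled[OF assms] by (intro integrableI_nonneg) auto
  show "(\<integral>t. indicator {0<..} t * (t powr (p - 1) * exp (- t * A)) \<partial>lborel) = Gamma p * A powr (- p)"
    using nn_integral_Gamma_scaled[OF assms] assms
    by (intro integral_eq_nn_integral[THEN trans]) (auto simp: Gamma_real_nonneg)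
qed

text \<open>\<open>cosh x\<close> is even, so reflecting the negative half line pairs
  \<open>exp (\<mu> * x)\<close> with \<open>exp (- \<mu> * x)\<close>, and their sum is
  \<open>2 * cosh (\<mu> * x)\<close>.\<close>

lemma Bessel_K_eq_whole_line:
  fixes \<mu> z :: real
  assumes int: "integrable lborel (\<lambda>x. exp (\<mu> * x - z * cosh x))"
  shows "(\<integral>x. exp (\<mu> * x - z * cosh x) \<partial>lborel) = 2 * Bessel_K \<mu> z"
proof -
  define E where "E x = exp (\<mu> * x - z * cosh x)" for x
  have E: "integrable lborel E" using int by (simp add: E_def[abs_def])
  let ?P = "\<lambda>x. indicator {0..} x *\<^sub>R E x" and ?N = "\<lambda>x. indicator {0..} x *\<^sub>R E (- x)"
  let ?M = "\<lambda>x. indicator {..0} x *\<^sub>R E x"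
  have P: "integrable lborel ?P"
    by (rule integrable_mult_indicator[OF _ E]) simp
  have M: "integrable lborel ?M"
    by (rule integrable_mult_indicator[OF _ E]) simp
  have M_neg: "?M (0 + (- 1) * x) = ?N x" for x by (auto split: split_indicator)
  have N: "integrable lborel ?N"
    using lborel_integrable_real_affine[OF M, of "- 1" 0] by (simp only: M_neg)
  have N_eq: "(\<integral>x. ?N x \<partial>lborel) = (\<integral>x. ?M x \<partial>lborel)"
    using lborel_integral_real_affine[of "- 1" ?M 0] by (simp only: M_neg) simp
  have cosh: "exp (- z * cosh x) * cosh (\<mu> * x) = (E x + E (- x)) / 2" for x
    by (simp add: E_def exp_diff cosh_field_def[of "\<mu> * x"] exp_minus field_simps)
  have "2 * Bessel_K \<mu> z = 2 * (\<integral>x. (?P x + ?N x) / 2 \<partial>lborel)"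
    unfolding Bessel_K_def set_lebesgue_integral_def cosh
    by (simp add: distrib_left add_divide_distrib)
  also have "\<dots> = (\<integral>x. ?P x \<partial>lborel) + (\<integral>x. ?M x \<partial>lborel)"
    unfolding N_eq[symmetric] using P N by simp
  also have "\<dots> = (\<integral>x. ?P x + ?M x \<partial>lborel)"
    using P M by simp
  also have "\<dots> = (\<integral>x. E x \<partial>lborel)"
  proof (rule integral_cong_AE)
    \<comment> \<open>Both half lines contain 0, so the identity fails at most at that one
      point.\<close>
    show "AE x in lborel. ?P x + ?M x = E x"
      using AE_lborel_singleton[of "0::real"] by eventually_elim (auto split: split_indicator)
  qed (use P M E in auto)
  finally show ?thesis by (simp add: E_def)
qed

lemma Bessel_K_substitution:
  fixes \<mu> a r :: real
  assumes "a > 0" "r > 0"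
    and int: "integrable lborel (\<lambda>t. indicator {0<..} t * (t powr (\<mu> - 1) * exp (- t * a\<^sup>2 - r\<^sup>2 / (4 * t))))"
  shows "(\<integral>t. indicator {0<..} t * (t powr (\<mu> - 1) * exp (- t * a\<^sup>2 - r\<^sup>2 / (4 * t))) \<partial>lborel) =
    2 * (r / (2 * a)) powr \<mu> * Bessel_K \<mu> (a * r)"
proof -
  \<comment> \<open>The substitution \<open>t = b * exp x\<close> makes the exponent proportional to \<open>cosh x\<close>.\<close>
  define b where "b = r / (2 * a)"
  have b: "b > 0" using assms by (simp add: b_def)
  define q where "q t = t powr (\<mu> - 1) * exp (- t * a\<^sup>2 - r\<^sup>2 / (4 * t))" for t
  define E where "E x = exp (\<mu> * x - (a * r) * cosh x)" for x
  have set_int: "set_integrable lborel {0<..} q"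
    using int by (simp add: set_integrable_def q_def)
  have sub: "\<bar>b * exp x\<bar> * q (b * exp x) = b powr \<mu> * E x" for x
  proof -
    have "b * exp x * (b * exp x) powr (\<mu> - 1) = (b * exp x) powr \<mu>"
      using b by (simp add: powr_diff)
    also have "\<dots> = b powr \<mu> * exp (\<mu> * x)"
      using b by (simp add: powr_mult exp_powr_real mult.commute)
    finally have 1: "b * exp x * (b * exp x) powr (\<mu> - 1) = b powr \<mu> * exp (\<mu> * x)" .
    \<comment> \<open>With \<open>b = r / (2 * a)\<close> the coefficients
      \<open>b * a\<^sup>2\<close> and \<open>r\<^sup>2 / (4 * b)\<close> both equal
      \<open>a * r / 2\<close>; the two exponentials combine into
      \<open>a * r * cosh x\<close>.\<close>
    have 2: "- (b * exp x) * a\<^sup>2 - r\<^sup>2 / (4 * (b * exp x)) = - (a * r) * cosh x"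
      using assms by (simp add: b_def cosh_field_def exp_minus field_simps power2_eq_square)
    have "\<bar>b * exp x\<bar> * q (b * exp x) =
        (b * exp x * (b * exp x) powr (\<mu> - 1)) * exp (- (b * exp x) * a\<^sup>2 - r\<^sup>2 / (4 * (b * exp x)))"
      using b unfolding q_def by (simp only: abs_of_pos mult_pos_pos exp_gt_zero mult.assoc)
    also have "\<dots> = b powr \<mu> * (exp (\<mu> * x) * exp (- (a * r) * cosh x))"
      unfolding 1 2 by (simp only: mult.assoc)
    also have "\<dots> = b powr \<mu> * E x"
      by (simp add: E_def mult_exp_exp)
    finally show ?thesis .
  qed
  have range: "range (\<lambda>x. b * exp x) = {0<..}"
  proof (intro equalityI subsetI)
    fix t :: real assume "t \<in> {0<..}"
    then have "t = b * exp (ln (t / b))" using b by simp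
    then show "t \<in> range (\<lambda>x. b * exp x)" by blast
  qed (use b in auto)
  have abs_q: "q absolutely_integrable_on {0<..}"
    using set_int set_borel_integral_eq_integral by (auto simp: set_integrable_def integrable_completion)
  have sub_fun: "(\<lambda>x. \<bar>b * exp x\<bar> * q (b * exp x)) = (\<lambda>x. b powr \<mu> * E x)"
    by (rule ext) (rule sub)
  have deriv: "((\<lambda>x. b * exp x) has_field_derivative b * exp x) (at x within UNIV)" for x
    by (auto intro!: derivative_eq_intros)
  have inj: "inj (\<lambda>x. b * exp x)"
    using b by (simp add: inj_def)
  \<comment> \<open>The change of variables transfers integrability as well as the value, so
    integrability of \<open>E\<close> over the whole line follows from that of
    \<open>q\<close>.\<close>
  have cov_both: "(\<lambda>x. b powr \<mu> * E x) absolutely_integrable_on UNIV \<and>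
      integral UNIV (\<lambda>x. b powr \<mu> * E x) = integral {0<..} q"
    using has_absolute_integral_change_of_variables_1'[of UNIV, OF _ deriv inj, of q "integral {0<..} q"] abs_q
    unfolding range sub_fun by simp
  note cov = conjunct1[OF cov_both] conjunct2[OF cov_both]
  have bE: "integrable lborel (\<lambda>x. b powr \<mu> * E x)"
  proof -
    have bE_meas: "(\<lambda>x. b powr \<mu> * E x) \<in> borel_measurable lborel"
      unfolding E_def[abs_def] by measurable
    have "integrable lebesgue (\<lambda>x. b powr \<mu> * E x)"
      using cov(1) unfolding set_integrable_def by (simp only: indicator_simps UNIV_I scaleR_one)
    then show ?thesis
      by (simp only: integrable_completion[OF bE_meas])
  qed
  then have E: "integrable lborel E" using b by simp
  have "(\<integral>t. indicator {0<..} t * (t powr (\<mu> - 1) * exp (- t * a\<^sup>2 - r\<^sup>2 / (4 * t))) \<partial>lborel) = integral {0<..} q"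
    using set_borel_integral_eq_integral(2)[OF set_int] by (simp add: set_lebesgue_integral_def q_def)
  also have "\<dots> = (\<integral>x. b powr \<mu> * E x \<partial>lborel)"
    unfolding cov(2)[symmetric] by (rule integral_lborel[OF bE])
  also have "\<dots> = b powr \<mu> * (2 * Bessel_K \<mu> (a * r))"
    using Bessel_K_eq_whole_line[of \<mu> "a * r"] E by (simp add: E_def[abs_def])
  finally show ?thesis by (simp add: b_def)
qed

lemma fourier_transform_inverse_power:
  fixes h :: "real^2" and p a :: real
  assumes "p > 0" "a > 0" "h \<noteq> 0"
    and int: "integrable lborel (\<lambda>l::real^2. ((norm l)\<^sup>2 + a\<^sup>2) powr (- p))"
  shows "(\<integral>l. cis (h \<bullet> l) * complex_of_real (((norm l)\<^sup>2 + a\<^sup>2) powr (- p)) \<partial>lborel) =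
    complex_of_real (2 * pi * (norm h / (2 * a)) powr (p - 1) * (Bessel_K (p - 1) (a * norm h) / Gamma p))"
proof -
  \<comment> \<open>Write the power as a Gamma integral over \<open>t\<close>; then the integral over \<open>l\<close> is Gaussian.\<close>
  define w where "w l t = indicator {0<..} t * (t powr (p - 1) * exp (- t * ((norm l)\<^sup>2 + a\<^sup>2)))"
    for l :: "real^2" and t :: real
  define \<Phi> where "\<Phi> = (\<lambda>(l, t). cis (h \<bullet> l) * complex_of_real (w l t))"
  have pos: "(norm l)\<^sup>2 + a\<^sup>2 > 0" for l :: "real^2"
    using assms by (simp add: add_nonneg_pos)
  have w_nonneg: "0 \<le> w l t" for l t by (simp add: w_def)
  have [measurable]: "\<Phi> \<in> borel_measurable (lborel \<Otimes>\<^sub>M lborel)"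
    unfolding \<Phi>_def w_def by measurable
  have w_int: "integrable lborel (w l)" "(\<integral>t. w l t \<partial>lborel) = Gamma p * ((norm l)\<^sup>2 + a\<^sup>2) powr (- p)" for l
    using Gamma_integral_scaled[OF assms(1) pos[of l]] by (simp_all add: w_def[abs_def])
  \<comment> \<open>The modulus of \<Phi> integrates in t to the Gamma factor times the inverse
    power, so \<open>int\<close> is precisely the integrability required for Fubini.\<close>
  have \<Phi>_int: "integrable (lborel \<Otimes>\<^sub>M lborel) \<Phi>"
  proof (rule lborel_pair.Fubini_integrable)
    show "integrable lborel (\<lambda>l. \<integral>t. norm (\<Phi> (l, t)) \<partial>lborel)"
      using int w_nonneg by (simp add: \<Phi>_def norm_mult w_int)
    show "AE l in lborel. integrable lborel (\<lambda>t. \<Phi> (l, t))"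
      using w_int by (simp add: \<Phi>_def)
  qed fact
  \<comment> \<open>In the plane the Gaussian transform contributes
    \<open>sqrt (pi / t) ^ 2 = pi / t\<close>. The extra division by t lowers the exponent from p -
    1 to p - 2, which is why the Bessel order is p - 1.\<close>
  define q where "q t = indicator {0<..} t * (t powr ((p - 1) - 1) * exp (- t * a\<^sup>2 - (norm h)\<^sup>2 / (4 * t)))"
    for t :: real
  have inner: "(\<integral>l. \<Phi> (l, t) \<partial>lborel) = complex_of_real (pi * q t)" for t
  proof (cases "t > 0")
    case True
    have "(\<integral>l. \<Phi> (l, t) \<partial>lborel) = (\<integral>l. complex_of_real (t powr (p - 1) * exp (- t * a\<^sup>2)) *
        (cis (h \<bullet> l) * complex_of_real (exp (- t * (norm l)\<^sup>2))) \<partial>lborel)"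
      using True by (intro Bochner_Integration.integral_cong) (auto simp: \<Phi>_def w_def algebra_simps exp_add[symmetric] exp_of_real[symmetric])
    also have "\<dots> = complex_of_real (t powr (p - 1) * exp (- t * a\<^sup>2)) *
        complex_of_real (sqrt (pi / t) ^ 2 * exp (- (norm h)\<^sup>2 / (4 * t)))"
      using gaussian_fourier[OF True, of h] by simp
    also have "\<dots> = complex_of_real (pi * q t)"
    proof -
      have "exp (- t * a\<^sup>2 - (norm h)\<^sup>2 / (4 * t)) = exp (- t * a\<^sup>2) * exp (- (norm h)\<^sup>2 / (4 * t))"
        by (simp add: mult_exp_exp)
      moreover have "t powr (p - 1 - 1) = t powr (p - 1) / t"
        using True by (simp only: powr_diff[of t "p - 1" 1]) simp
      moreover have "sqrt (pi / t) ^ 2 = pi / t"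
        using True by simp
      ultimately have "pi * q t =
          t powr (p - 1) * exp (- t * a\<^sup>2) * (sqrt (pi / t) ^ 2 * exp (- (norm h)\<^sup>2 / (4 * t)))"
        using True by (simp only: q_def indicator_simps greaterThan_iff mult_1 times_divide_eq_left times_divide_eq_right mult_ac)
      then show ?thesis by (simp only: of_real_mult)
    qed
    finally show ?thesis .
  qed (simp add: \<Phi>_def w_def q_def)
  \<comment> \<open>Up to the factor pi, \<open>q\<close> is the partial integral of \<Phi>, so
    Fubini also supplies its integrability.\<close>
  have q_int: "integrable lborel q"
  proof -
    have "integrable lborel (\<lambda>t. \<integral>l. \<Phi> (l, t) \<partial>lborel)"
      using lborel_pair.integrable_snd[of "\<lambda>l t. \<Phi> (l, t)"] \<Phi>_int by simp
    then have "integrable lborel (\<lambda>t. Re (complex_of_real (pi * q t)))"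
      unfolding inner by (rule integrable_Re)
    then show ?thesis by simp
  qed
  have "complex_of_real (Gamma p) * (\<integral>l. cis (h \<bullet> l) * complex_of_real (((norm l)\<^sup>2 + a\<^sup>2) powr (- p)) \<partial>lborel) =
      (\<integral>l. cis (h \<bullet> l) * complex_of_real (\<integral>t. w l t \<partial>lborel) \<partial>lborel)"
    by (simp add: w_int mult_ac flip: integral_mult_right_zero)
  also have "\<dots> = (\<integral>l. \<integral>t. \<Phi> (l, t) \<partial>lborel \<partial>lborel)"
    by (simp add: \<Phi>_def)
  also have "\<dots> = (\<integral>t. \<integral>l. \<Phi> (l, t) \<partial>lborel \<partial>lborel)"
    using lborel_pair.Fubini_integral[of "\<lambda>l t. \<Phi> (l, t)"] \<Phi>_int by simp
  also have "\<dots> = complex_of_real (pi * (\<integral>t. q t \<partial>lborel))"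
    unfolding inner by (simp only: integral_complex_of_real integral_mult_right_zero)
  also have "(\<integral>t. q t \<partial>lborel) = 2 * (norm h / (2 * a)) powr (p - 1) * Bessel_K (p - 1) (a * norm h)"
    using q_int assms unfolding q_def by (intro Bessel_K_substitution) (auto simp: q_def[abs_def])
  finally have eq: "complex_of_real (Gamma p) *
      (\<integral>l. cis (h \<bullet> l) * complex_of_real (((norm l)\<^sup>2 + a\<^sup>2) powr (- p)) \<partial>lborel) =
      complex_of_real (pi * (2 * (norm h / (2 * a)) powr (p - 1) * Bessel_K (p - 1) (a * norm h)))" .
  have "Gamma p \<noteq> 0" using Gamma_real_pos[OF assms(1)] by simp
  then show ?thesis
    using arg_cong[OF eq, of "\<lambda>z. z / complex_of_real (Gamma p)"] by (simp add: mult_ac)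
qed

section \<open>Uniqueness of Fourier coefficients\<close>

lemma integrable_bounded_mult:
  fixes d g :: "real \<Rightarrow> complex"
  assumes "integrable lborel d" "g \<in> borel_measurable borel" "\<And>w. cmod (g w) \<le> B"
  shows "integrable lborel (\<lambda>w. g w * d w)"
proof (rule Bochner_Integration.integrable_bound)
  show "integrable lborel (\<lambda>w. B * cmod (d w))"
    using assms(1) by auto
  show "(\<lambda>w. g w * d w) \<in> borel_measurable lborel"
    using assms by auto
  show "AE w in lborel. norm (g w * d w) \<le> norm (B * cmod (d w))"
    using assms(3) by (intro AE_I2) (auto simp: norm_mult abs_mult intro!: mult_right_mono order_trans[OF _ abs_ge_self])
qed

text \<open>The class below is closed under multiplication by polynomials in \<open>cis\<close>. By
  Stone-Weierstrass on the unit circle, such a function integrates to zero against every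
  continuous function of \<open>cis\<close>, and then over the preimage of every closed and every Borel set.\<close>

definition fourier_null :: "(real \<Rightarrow> complex) \<Rightarrow> bool" where
  "fourier_null d \<longleftrightarrow>
     integrable lborel d \<and> (\<forall>u::int. (\<integral>w. cis (of_int u * w) * d w \<partial>lborel) = 0)"

lemma fourier_null_integrable:
  "fourier_null d \<Longrightarrow> integrable lborel (\<lambda>w. cis (r * w) * d w)"
  by (rule integrable_bounded_mult[where B = 1]) (auto simp: fourier_null_def)

lemma fourier_null_cis_mult:
  assumes "fourier_null d"
  shows "fourier_null (\<lambda>w. cis (of_int k * w) * d w)"
proof -
  have "cis (of_int u * w) * (cis (of_int k * w) * d w) = cis (of_int (u + k) * w) * d w" for u w
    by (simp only: mult.assoc[symmetric] cis_mult of_int_add distrib_right)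
  with assms fourier_null_integrable[OF assms] show ?thesis
    by (simp only: fourier_null_def) blast
qed

lemma fourier_null_add:
  assumes "fourier_null d" "fourier_null e"
  shows "fourier_null (\<lambda>w. d w + e w)"
  using assms fourier_null_integrable[OF assms(1)] fourier_null_integrable[OF assms(2)]
  by (auto simp: fourier_null_def distrib_left)

lemma fourier_null_cmult:
  assumes "fourier_null d"
  shows "fourier_null (\<lambda>w. a * d w)"
  using assms integral_mult_right_zero[of lborel a] unfolding fourier_null_def
  by (simp add: mult.left_commute[of _ a])

lemma fourier_null_polynomial_mult:
  assumes "real_polynomial_function p" "fourier_null d"
  shows "fourier_null (\<lambda>w. complex_of_real (p (cis w)) * d w)"
  using assms
proof (induction p arbitrary: d rule: real_polynomial_function.induct)
  case (linear p)
  \<comment> \<open>A real-linear \<open>p\<close> satisfies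
    \<open>p (cis w) = cos w * p 1 + sin w * p \<i>\<close>. Euler's formulas turn this into a
    combination of \<open>cis w\<close> and \<open>cis (- w)\<close> with coefficients
    \<open>a\<close> and \<open>b\<close>.\<close>
  define a b where "a = (of_real (p 1) - \<i> * of_real (p \<i>)) / 2"
    and "b = (of_real (p 1) + \<i> * of_real (p \<i>)) / 2"
  have "fourier_null (\<lambda>w. a * (cis (of_int 1 * w) * d w) + b * (cis (of_int (-1) * w) * d w))"
    using linear.prems by (intro fourier_null_add fourier_null_cmult fourier_null_cis_mult)
  moreover have "a * (cis (of_int 1 * w) * d w) + b * (cis (of_int (-1) * w) * d w) =
      of_real (p (cis w)) * d w" for w
  proof -
    interpret bounded_linear p by fact
    have "cis w = cos w *\<^sub>R 1 + sin w *\<^sub>R \<i>"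
      by (simp add: complex_eq_iff)
    then have "p (cis w) = cos w * p 1 + sin w * p \<i>"
      by (simp only: add scaleR) simp
    then have "a * cis w + b * cis (- w) = of_real (p (cis w))"
      by (simp add: a_def b_def complex_eq_iff field_simps)
    moreover have "a * (cis (of_int 1 * w) * d w) + b * (cis (of_int (-1) * w) * d w) =
        (a * cis w + b * cis (- w)) * d w"
      by (simp add: algebra_simps)
    ultimately show ?thesis by simp
  qed
  ultimately show ?case by simp
next
  case (const c)
  then show ?case by (simp add: fourier_null_cmult)
next
  case (add p q)
  then show ?case by (simp add: distrib_right fourier_null_add)
next
  case (mult p q)
  \<comment> \<open>The induction is general in \<open>d\<close>: the hypothesis for
    \<open>p\<close> is applied to the product of \<open>q\<close> with \<open>d\<close>.\<close>
  from mult.IH(1)[OF mult.IH(2)[OF mult.prems]] show ?case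
    by (simp add: mult.assoc)
qed

lemma fourier_null_continuous:
  fixes F :: "complex \<Rightarrow> real"
  assumes d: "fourier_null d" and F: "continuous_on UNIV F"
  shows "(\<integral>w. complex_of_real (F (cis w)) * d w \<partial>lborel) = 0" (is "?I = 0")
proof -
  have [measurable]: "F \<in> borel_measurable borel"
    using F by (rule borel_measurable_continuous_onI)
  have d_int: "integrable lborel d" using d by (simp add: fourier_null_def)
  let ?J = "\<integral>w. cmod (d w) \<partial>lborel"
  have "compact (F ` sphere 0 1)"
    using F by (intro compact_continuous_image compact_sphere) (auto intro: continuous_on_subset)
  then obtain C where C: "\<And>z. z \<in> sphere 0 1 \<Longrightarrow> \<bar>F z\<bar> \<le> C"
    by (force dest!: compact_imp_bounded simp: bounded_iff)
  have F_int: "integrable lborel (\<lambda>w. complex_of_real (F (cis w)) * d w)"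
    using C by (intro integrable_bounded_mult[where B = C] d_int) auto
  have le: "cmod ?I \<le> e * ?J" if e: "e > 0" for e :: real
  proof -
    obtain p where p: "real_polynomial_function p" "\<And>z. z \<in> sphere 0 1 \<Longrightarrow> \<bar>F z - p z\<bar> < e"
      by (rule Stone_Weierstrass_real_polynomial_function[of "sphere 0 1" F e])
        (use F e in \<open>auto intro: continuous_on_subset\<close>)
    have null: "fourier_null (\<lambda>w. complex_of_real (p (cis w)) * d w)"
      using p(1) d by (rule fourier_null_polynomial_mult)
    then have "(\<integral>w. complex_of_real (p (cis w)) * d w \<partial>lborel) = 0"
      unfolding fourier_null_def by (auto dest: spec[of _ 0])
    then have "?I = (\<integral>w. complex_of_real (F (cis w)) * d w - complex_of_real (p (cis w)) * d w \<partial>lborel)"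
      using null F_int by (simp add: fourier_null_def)
    also have "cmod \<dots> \<le> (\<integral>w. e * cmod (d w) \<partial>lborel)"
    proof (rule Bochner_Integration.integral_norm_bound_integral)
      show "integrable lborel (\<lambda>w. complex_of_real (F (cis w)) * d w - complex_of_real (p (cis w)) * d w)"
        using null F_int by (simp add: fourier_null_def)
      show "integrable lborel (\<lambda>w. e * cmod (d w))" using d_int by auto
      fix w
      show "cmod (complex_of_real (F (cis w)) * d w - complex_of_real (p (cis w)) * d w) \<le> e * cmod (d w)"
        using p(2)[of "cis w"]
        by (auto simp: norm_mult simp flip: left_diff_distrib of_real_diff intro!: mult_right_mono)
    qed
    finally show ?thesis by simp
  qed
  have "cmod ?I \<le> 0"
  proof (rule field_le_epsilon)
    fix e :: real assume "e > 0"
    have J: "?J \<ge> 0" by simp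
    \<comment> \<open>Dividing by \<open>?J + 1\<close> rather than \<open>?J\<close> covers the
      case where \<open>?J\<close> is 0.\<close>
    have "cmod ?I \<le> e / (?J + 1) * ?J"
      using \<open>e > 0\<close> J by (intro le) (simp add: add_nonneg_pos)
    also have "\<dots> \<le> e"
      using \<open>e > 0\<close> J by (simp add: divide_simps add_nonneg_pos)
    finally show "cmod ?I \<le> 0 + e" by simp
  qed
  then show ?thesis by simp
qed

text \<open>The indicator of a closed set is the pointwise limit of the continuous tent functions
  \<open>F k\<close>, which take values between 0 and 1; dominated convergence carries the vanishing
  integrals over.\<close>

lemma fourier_null_closed:
  assumes d: "fourier_null d" and K: "closed K"
  shows "(LINT w:(cis -` K)|lborel. d w) = 0"
\<comment> \<open>The empty set is separate because \<open>infdist\<close> to it is 0 by convention,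
  which would make every \<open>F k\<close> constantly 1.\<close>
proof (cases "K = {}")
  case False
  have [measurable]: "d \<in> borel_measurable borel" "K \<in> sets borel"
    using d K by (auto simp: fourier_null_def)
  define F where "F k z = max 0 (1 - real k * infdist z K)" for k z
  have [measurable]: "F k \<in> borel_measurable borel" for k
    unfolding F_def[abs_def] by (intro borel_measurable_continuous_onI continuous_intros)
  have [measurable]: "cis -` K \<in> sets borel"
    using measurable_sets[OF measurable_cis, of K] by simp
  have "(\<lambda>k. \<integral>w. complex_of_real (F k (cis w)) * d w \<partial>lborel) \<longlonglongrightarrow>
    (\<integral>w. indicator (cis -` K) w *\<^sub>R d w \<partial>lborel)"
  proof (rule integral_dominated_convergence[where w = "\<lambda>w. cmod (d w)"])
    show "AE w in lborel. (\<lambda>k. complex_of_real (F k (cis w)) * d w) \<longlonglongrightarrow> indicator (cis -` K) w *\<^sub>R d w"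
    proof (rule AE_I2)
      fix w
      have "(\<lambda>k. F k (cis w)) \<longlonglongrightarrow> indicator (cis -` K) w"
      proof (cases "cis w \<in> K")
        case True
        then show ?thesis by (simp add: F_def)
      next
        case False
        then have pos: "infdist (cis w) K > 0"
          using K \<open>K \<noteq> {}\<close> by (simp add: infdist_pos_not_in_closed)
        obtain N where N: "1 < real N * infdist (cis w) K"
          using reals_Archimedean3[OF pos] by blast
        have "F k (cis w) = 0" if "k \<ge> N" for k
        proof -
          have "real N * infdist (cis w) K \<le> real k * infdist (cis w) K"
            using that pos by (intro mult_right_mono) auto
          with N show ?thesis by (simp add: F_def)
        qed
        then have "\<forall>\<^sub>F k in sequentially. F k (cis w) = 0"
          by (auto simp: eventually_sequentially)
        with False show ?thesis by (simp add: tendsto_eventually)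
      qed
      then show "(\<lambda>k. complex_of_real (F k (cis w)) * d w) \<longlonglongrightarrow> indicator (cis -` K) w *\<^sub>R d w"
        unfolding scaleR_conv_of_real by (intro tendsto_intros)
    qed
    show "AE w in lborel. norm (complex_of_real (F k (cis w)) * d w) \<le> cmod (d w)" for k
      by (intro AE_I2) (auto simp: norm_mult F_def infdist_nonneg intro!: mult_left_le_one_le)
  qed (use d in \<open>auto simp: fourier_null_def\<close>)
  moreover have "(\<integral>w. complex_of_real (F k (cis w)) * d w \<partial>lborel) = 0" for k
    unfolding F_def by (intro fourier_null_continuous[OF d] continuous_intros)
  ultimately show ?thesis
    by (simp add: set_lebesgue_integral_def LIMSEQ_const_iff)
qed (simp add: set_lebesgue_integral_def)

text \<open>A Dynkin system argument: closed sets are stable under intersection and generate the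
  Borel sets. Complements are handled by the zeroth coefficient, which says that the total integral
  is zero.\<close>

lemma fourier_null_borel:
  assumes d: "fourier_null d" and B: "B \<in> sets borel"
  shows "(LINT w:(cis -` B)|lborel. d w) = 0"
proof -
  have d_int: "integrable lborel d" and d0: "(\<integral>w. d w \<partial>lborel) = 0"
    using d by (auto simp: fourier_null_def dest: spec[of _ 0])
  have pre: "cis -` A \<in> sets borel" if "A \<in> sets borel" for A
    using measurable_sets[OF measurable_cis, of A] that by simp
  have set_int: "set_integrable lborel (cis -` A) d" if "A \<in> sets borel" for A
    using d_int pre[OF that] unfolding set_integrable_def by (intro integrable_mult_indicator) auto
  have borel: "sets borel = sigma_sets UNIV (Collect (closed :: complex set \<Rightarrow> bool))"
    by (subst borel_eq_closed) simp
  have "Int_stable (Collect (closed :: complex set \<Rightarrow> bool))"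
    by (auto simp: Int_stable_def)
  moreover have "Collect (closed :: complex set \<Rightarrow> bool) \<subseteq> Pow UNIV"
    by simp
  moreover have "B \<in> sigma_sets UNIV (Collect closed)"
    using B by (simp add: borel)
  ultimately show ?thesis
  proof (induction rule: sigma_sets_induct_disjoint)
    case (basic A)
    then show ?case using fourier_null_closed[OF d] by simp
  next
    case (compl A)
    then have A: "A \<in> sets borel" by (simp add: borel)
    have "indicator (cis -` (UNIV - A)) w *\<^sub>R d w = d w - indicator (cis -` A) w *\<^sub>R d w" for w
      by (auto split: split_indicator)
    then show ?case
      using compl.IH d0 d_int set_int[OF A]
      by (simp add: set_lebesgue_integral_def set_integrable_def)
  next
    case (union A)
    have A: "A i \<in> sets borel" for i using union.hyps(2) by (auto simp: borel)
    have UA: "(\<Union>i. A i) \<in> sets borel" using A by auto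
    have "(LINT w:(\<Union>i. cis -` A i)|lborel. d w) = (\<Sum>i. LINT w:(cis -` A i)|lborel. d w)"
    proof (rule lebesgue_integral_countable_add)
      show "set_integrable lborel (\<Union>i. cis -` A i) d"
        using set_int[OF UA] by (simp add: vimage_UN)
      show "cis -` A i \<in> sets lborel" for i using pre[OF A] by simp
      show "cis -` A i \<inter> cis -` A j = {}" if "i \<noteq> j" for i j
        using union.hyps(1) that by (auto simp: disjoint_family_on_def)
    qed
    then show ?case using union.IH by (simp add: vimage_UN)
  qed (simp_all add: set_lebesgue_integral_def)
qed

text \<open>On the open interval from -pi to pi, \<open>cis\<close> has a Borel measurable left
  inverse, so any Borel set agrees there with a preimage under \<open>cis\<close>. The endpoints,
  which \<open>cis\<close> identifies, form a null set, and \<open>d\<close> vanishes further out.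
  Hence \<open>d\<close> integrates to zero over every Borel set.\<close>

lemma fourier_null_imp_AE_zero:
  assumes d: "fourier_null d" and out: "\<And>w. w \<notin> {-pi..pi} \<Longrightarrow> d w = 0"
  shows "AE w in lborel. d w = 0"
proof (rule sigma_finite_measure.density_zero[OF lborel.sigma_finite_measure_axioms])
  show "integrable lborel d" using d by (simp add: fourier_null_def)
  fix A :: "real set" assume A: "A \<in> sets lborel"
  \<comment> \<open>\<open>Arg\<close> jumps on the negative real axis; cutting it off there leaves
    a Borel function, continuous on the slit plane.\<close>
  define arg where "arg z = indicator (- \<real>\<^sub>\<le>\<^sub>0) z *\<^sub>R Arg z" for z
  have arg [measurable]: "arg \<in> borel_measurable borel"
    unfolding arg_def[abs_def]
    by (intro borel_measurable_continuous_on_indicator continuous_on_Arg) auto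
  have mem: "cis w \<in> arg -` A \<longleftrightarrow> w \<in> A" if "w \<in> {-pi<..<pi}" for w
  proof -
    have "Arg (cis w) = w" using that by (intro Arg_cis) auto
    moreover have "cis w \<notin> \<real>\<^sub>\<le>\<^sub>0"
      using that \<open>Arg (cis w) = w\<close> by (metis Arg_eq_pi greaterThanLessThan_iff cis_neq_zero complex_nonpos_Reals_iff less_irrefl order_le_less complex_eq_iff zero_complex.sel)
    ultimately show ?thesis by (simp add: arg_def)
  qed
  have "AE w in lborel. indicator A w *\<^sub>R d w = indicator (cis -` arg -` A) w *\<^sub>R d w"
    using AE_lborel_singleton[of pi] AE_lborel_singleton[of "- pi"]
  proof eventually_elim
    case (elim w)
    then show ?case using out[of w] mem[of w] by (cases "w \<in> {-pi<..<pi}") (auto split: split_indicator)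
  qed
  moreover have "arg -` A \<in> sets borel"
    using measurable_sets[OF arg, of A] A by simp
  moreover have "cis -` arg -` A \<in> sets borel"
    using measurable_sets[OF measurable_cis \<open>arg -` A \<in> sets borel\<close>] by simp
  moreover have "d \<in> borel_measurable borel"
    using d by (auto simp: fourier_null_def)
  ultimately show "(LINT w:A|lborel. d w) = 0"
    using fourier_null_borel[OF d, of "arg -` A"] A
    unfolding set_lebesgue_integral_def by (subst integral_cong_AE) auto
qed

section \<open>The spectral density\<close>

text \<open>For a real exponent the branch term \<open>2 * k * pi * \<i>\<close> contributes only a
  phase.\<close>

lemma cmod_power_branch:
  assumes "z \<noteq> 0"
  shows "cmod (power_branch k z \<nu>) = cmod z powr \<nu>"
  using assms by (simp add: power_branch_def powr_def)

lemma cmod_operator_symbol_square: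
  assumes "cmod (c w) > 0"
  shows "(cmod (operator_symbol k \<nu> c l w))\<^sup>2 = ((norm l)\<^sup>2 + (cmod (c w))\<^sup>2) powr (2 * \<nu>)"
proof -
  have pos: "(norm l)\<^sup>2 + (cmod (c w))\<^sup>2 > 0"
    using assms by (simp add: add_nonneg_pos)
  define z where "z = complex_of_real (- (norm l)\<^sup>2 - (cmod (c w))\<^sup>2)"
  have z: "cmod z = (norm l)\<^sup>2 + (cmod (c w))\<^sup>2"
    unfolding z_def norm_of_real using pos by linarith
  then have nz: "z \<noteq> 0" using pos by auto
  have "(cmod (operator_symbol k \<nu> c l w))\<^sup>2 = (((norm l)\<^sup>2 + (cmod (c w))\<^sup>2) powr \<nu>)\<^sup>2"
    by (simp only: operator_symbol_def z_def[symmetric] cmod_power_branch[OF nz] z)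
  then show ?thesis
    by (simp only: power2_eq_square powr_add[symmetric] mult_2)
qed

section \<open>The frequency space and identification of the density\<close>

lemma freq_slab_borel: "UNIV \<times> {-pi..pi} \<in> sets (borel :: ((real^2) \<times> real) measure)"
  by (intro borel_closed closed_Times) auto

lemma freq_space_alt: "freq_space = restrict_space (lborel \<Otimes>\<^sub>M lborel) (UNIV \<times> {-pi..pi})"
  by (simp add: freq_space_def lborel_prod)

lemma space_freq_space: "space freq_space = UNIV \<times> {-pi..pi}"
  by (simp add: freq_space_def space_restrict_space)

lemma sigma_finite_freq_space: "sigma_finite_measure freq_space"
  unfolding freq_space_def
  by (intro sigma_finite_measure_restrict_space lborel.sigma_finite_measure_axioms) (simp add: freq_slab_borel)

lemma emeasure_freq_space_bounded:
  assumes "A \<in> sets freq_space" "bounded A"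
  shows "emeasure freq_space A < \<infinity>"
proof -
  have "A \<in> sets lborel" "A \<subseteq> UNIV \<times> {-pi..pi}"
    using assms(1) by (auto simp: freq_space_def sets_restrict_space_iff freq_slab_borel)
  then have "emeasure freq_space A = emeasure lborel A"
    unfolding freq_space_def by (intro emeasure_restrict_space) (auto simp: freq_slab_borel)
  also have "\<dots> < \<infinity>" using assms(2) by (intro emeasure_bounded_finite)
  finally show ?thesis .
qed

text \<open>The equation tests only frequency sets of finite measure, whereas uniqueness of
  densities tests all sets. Multiplying by indicators of the bounded sets \<open>U N\<close>
  reconciles the two, and these sets exhaust the space.\<close>

lemma AE_eq_of_finite_measure_sets:
  fixes f g :: "(real^2) \<times> real \<Rightarrow> ennreal"
  assumes [measurable]: "f \<in> borel_measurable freq_space" "g \<in> borel_measurable freq_space"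
    and eq: "\<And>A. A \<in> sets freq_space \<Longrightarrow> emeasure freq_space A < \<infinity> \<Longrightarrow>
      (\<integral>\<^sup>+x\<in>A. f x \<partial>freq_space) = (\<integral>\<^sup>+x\<in>A. g x \<partial>freq_space)"
  shows "AE x in freq_space. f x = g x"
proof -
  define U where "U N = cball 0 (real N) \<inter> (UNIV \<times> {-pi..pi} :: ((real^2) \<times> real) set)" for N :: nat
  have U [measurable]: "U N \<in> sets freq_space" for N
    unfolding freq_space_def U_def
    by (subst sets_restrict_space_iff) (simp_all add: freq_slab_borel sets.Int)
  have "AE x in freq_space. f x * indicator (U N) x = g x * indicator (U N) x" for N
  proof (rule sigma_finite_measure.density_unique2[OF sigma_finite_freq_space])
    fix A assume A: "A \<in> sets freq_space"
    have "bounded (A \<inter> U N)"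
      unfolding U_def by (rule bounded_subset[OF bounded_cball]) auto
    then have "emeasure freq_space (A \<inter> U N) < \<infinity>"
      using A by (intro emeasure_freq_space_bounded) auto
    then have "(\<integral>\<^sup>+x\<in>A \<inter> U N. f x \<partial>freq_space) = (\<integral>\<^sup>+x\<in>A \<inter> U N. g x \<partial>freq_space)"
      using A by (intro eq) auto
    then show "(\<integral>\<^sup>+x\<in>A. f x * indicator (U N) x \<partial>freq_space) = (\<integral>\<^sup>+x\<in>A. g x * indicator (U N) x \<partial>freq_space)"
      by (simp add: indicator_inter_arith mult_ac)
  qed measurable
  then have "AE x in freq_space. \<forall>N. f x * indicator (U N) x = g x * indicator (U N) x"
    by (simp add: AE_all_countable)
  then show ?thesis
  proof (rule AE_mp, intro AE_I2 impI)
    fix x assume x: "x \<in> space freq_space"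
      and all: "\<forall>N. f x * indicator (U N) x = g x * indicator (U N) x"
    obtain N where "norm x \<le> real N" using real_arch_simple by blast
    with x have "x \<in> U N" by (auto simp: U_def space_freq_space)
    with all show "f x = g x" by (auto dest!: spec[of _ N])
  qed
qed

text \<open>The isometry sees only the modulus of the integrand: the phase
  \<open>cis (s \<bullet> l)\<close> disappears and the normalization enters squared.
  \<open>H\<close> is a measurable expression for the squared modulus of the multiplier on the
  frequency interval.\<close>

lemma nn_integral_dft_increment:
  assumes Z: "orthogonal_increments P (spectral_control f) Z"
    and X: "has_dft_increment P f Z n m s A X"
    and f [measurable]: "(\<lambda>x. f (fst x) (snd x)) \<in> borel_measurable freq_space"
    and A [measurable]: "A \<in> sets freq_space"
    and H [measurable]: "(\<lambda>x. H (fst x) (snd x)) \<in> borel_measurable freq_space"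
    and H_eq: "\<And>l w. w \<in> {-pi..pi} \<Longrightarrow> (cmod (m l w))\<^sup>2 = H l w"
    and f_nonneg: "\<And>l w. w \<in> {-pi..pi} \<Longrightarrow> 0 \<le> f l w"
  shows "(\<integral>\<^sup>+x. ennreal ((cmod (X x))\<^sup>2) \<partial>P) =
    ennreal (real n / (2 * pi)) * (\<integral>\<^sup>+(l, w)\<in>A. ennreal (f l w * H l w) \<partial>freq_space)"
proof -
  define \<phi> where "\<phi> = (\<lambda>(l, w). indicator A (l, w) *
    (m l w * cis (s \<bullet> l) * complex_of_real (sqrt (real n / (2 * pi)))))"
  have \<phi>: "has_stoch_integral P (spectral_control f) Z \<phi> X"
    using X by (simp add: has_dft_increment_def \<phi>_def)
  then have [measurable]: "\<phi> \<in> borel_measurable freq_space"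
    by (simp add: has_stoch_integral_def spectral_control_def)
  have "(\<integral>\<^sup>+x. ennreal ((cmod (X x))\<^sup>2) \<partial>P) = (\<integral>\<^sup>+a. ennreal ((cmod (\<phi> a))\<^sup>2) \<partial>spectral_control f)"
    by (rule stoch_integral_isometry[OF Z \<phi>, symmetric])
  also have "\<dots> = (\<integral>\<^sup>+a. (case a of (l, w) \<Rightarrow> ennreal (f l w)) * ennreal ((cmod (\<phi> a))\<^sup>2) \<partial>freq_space)"
    unfolding spectral_control_def by (subst nn_integral_density) (simp_all add: case_prod_unfold)
  also have "\<dots> = (\<integral>\<^sup>+a. ennreal (real n / (2 * pi)) *
      (case a of (l, w) \<Rightarrow> ennreal (f l w * H l w) * indicator A (l, w)) \<partial>freq_space)"
  proof (rule nn_integral_cong)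
    fix a :: "(real^2) \<times> real" assume a: "a \<in> space freq_space"
    obtain l w where lw: "a = (l, w)" by (cases a)
    have w: "w \<in> {-pi..pi}" using a by (simp add: lw space_freq_space)
    have "(cmod (\<phi> a))\<^sup>2 = indicator A a * (H l w * (real n / (2 * pi)))"
      using w by (simp add: lw \<phi>_def norm_mult power_mult_distrib H_eq indicator_def)
    moreover have "0 \<le> H l w" using H_eq[OF w, of l] by (metis zero_le_power2)
    ultimately show "(case a of (l, w) \<Rightarrow> ennreal (f l w)) * ennreal ((cmod (\<phi> a))\<^sup>2) =
        ennreal (real n / (2 * pi)) * (case a of (l, w) \<Rightarrow> ennreal (f l w * H l w) * indicator A (l, w))"
      using f_nonneg[OF w, of l]
      by (auto simp: lw ennreal_mult[symmetric] mult_ac split: split_indicator)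
  qed
  also have "\<dots> = ennreal (real n / (2 * pi)) *
      (\<integral>\<^sup>+(l, w)\<in>A. ennreal (f l w * H l w) \<partial>freq_space)"
    by (subst nn_integral_cmult) (auto simp: case_prod_unfold)
  finally show ?thesis .
qed

lemma norm_square_vec2: "(norm (l :: real^2))\<^sup>2 = (l $ 1)\<^sup>2 + (l $ 2)\<^sup>2"
  by (simp add: norm_vec_def L2_set_def UNIV_2 real_norm_def)

text \<open>Both sides of the equation share a version \<open>X\<close>, whose second moment is
  computed once from each side. Here \<open>C\<close> stands for a positive measurable extension of
  the modulus of \<open>c\<close> to the whole line.\<close>

lemma spectral_density_eq:
  assumes f_dens: "spectral_density P Y f"
    and Z\<^sub>Y: "orthogonal_increments P (spectral_control f) Z\<^sub>Y"
    and Z\<^sub>e: "orthogonal_increments P (spectral_control (white_noise_density \<sigma>)) Z\<^sub>e"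
    and n: "n \<ge> 1"
    and C [measurable]: "C \<in> borel_measurable borel" and C_eq: "\<And>w. w \<in> {-pi..pi} \<Longrightarrow> C w = cmod (c w)"
    and C_pos: "\<And>w. C w > 0"
    and eqn: "satisfies_dft_equation P f Z\<^sub>Y \<sigma> Z\<^sub>e n k \<nu> c"
  shows "AE x in freq_space. f (fst x) (snd x) =
    \<sigma>\<^sup>2 / (2 * pi)\<^sup>2 * ((norm (fst x))\<^sup>2 + (C (snd x))\<^sup>2) powr (- (2 * \<nu>))"
proof -
  define H where "H l w = ((norm l)\<^sup>2 + (C w)\<^sup>2) powr (2 * \<nu>)" for l :: "real^2" and w
  have f_nonneg: "0 \<le> f l w" if "w \<in> {-pi..pi}" for l w
    using f_dens that by (auto simp: spectral_density_def)
  have f_meas [measurable]: "(\<lambda>x. f (fst x) (snd x)) \<in> borel_measurable freq_space"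
    using f_dens by (auto simp: spectral_density_def case_prod_unfold)
  have H_meas [measurable]: "(\<lambda>x. H (fst x) (snd x)) \<in> borel_measurable freq_space"
    unfolding freq_space_alt by (intro measurable_restrict_space1) (simp add: H_def)
  have H_eq: "(cmod (operator_symbol k \<nu> c l w))\<^sup>2 = H l w" if "w \<in> {-pi..pi}" for l w
    using C_pos[of w] that by (simp add: H_def C_eq cmod_operator_symbol_square)
  have "AE x in freq_space. (case x of (l, w) \<Rightarrow> ennreal (f l w * H l w)) =
      (case x of (l, w) \<Rightarrow> ennreal (\<sigma>\<^sup>2 / (2 * pi)\<^sup>2 * 1))"
  proof (rule AE_eq_of_finite_measure_sets)
    fix A assume A: "A \<in> sets freq_space" "emeasure freq_space A < \<infinity>"
    then obtain X where X: "has_dft_increment P f Z\<^sub>Y n (operator_symbol k \<nu> c) 0 A X"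
      "has_dft_increment P (white_noise_density \<sigma>) Z\<^sub>e n (\<lambda>l w. 1) 0 A X"
      using eqn unfolding satisfies_dft_equation_def by blast
    have "ennreal (real n / (2 * pi)) * (\<integral>\<^sup>+(l, w)\<in>A. ennreal (f l w * H l w) \<partial>freq_space) =
        ennreal (real n / (2 * pi)) * (\<integral>\<^sup>+(l, w)\<in>A. ennreal (\<sigma>\<^sup>2 / (2 * pi)\<^sup>2 * 1) \<partial>freq_space)"
      using nn_integral_dft_increment[OF Z\<^sub>Y X(1) f_meas A(1) H_meas H_eq f_nonneg]
        nn_integral_dft_increment[OF Z\<^sub>e X(2) _ A(1), of "\<lambda>l w. 1"] by simp
    \<comment> \<open>Cancelling the common factor in \<open>ennreal\<close> requires it to be
      nonzero and finite; \<open>n \<ge> 1\<close> ensures that it is nonzero.\<close>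
    moreover have "ennreal (real n / (2 * pi)) \<noteq> 0" "ennreal (real n / (2 * pi)) \<noteq> \<infinity>"
      using n by (auto simp: ennreal_eq_0_iff not_le)
    ultimately show "(\<integral>\<^sup>+x\<in>A. (case x of (l, w) \<Rightarrow> ennreal (f l w * H l w)) \<partial>freq_space) =
        (\<integral>\<^sup>+x\<in>A. (case x of (l, w) \<Rightarrow> ennreal (\<sigma>\<^sup>2 / (2 * pi)\<^sup>2 * 1)) \<partial>freq_space)"
      by (simp add: ennreal_mult_cancel_left case_prod_unfold)
  qed (simp_all add: case_prod_unfold)
  then show ?thesis
  proof (rule AE_mp, intro AE_I2 impI)
    fix x assume x: "x \<in> space freq_space"
      and eq: "(case x of (l, w) \<Rightarrow> ennreal (f l w * H l w)) = (case x of (l, w) \<Rightarrow> ennreal (\<sigma>\<^sup>2 / (2 * pi)\<^sup>2 * 1))"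
    obtain l w where lw: "x = (l, w)" by (cases x)
    have "0 \<le> f l w" using x by (intro f_nonneg) (simp add: lw space_freq_space)
    with eq have "f l w * H l w = \<sigma>\<^sup>2 / (2 * pi)\<^sup>2"
      by (simp add: lw H_def)
    moreover have "H l w > 0" using C_pos[of w] by (simp add: H_def add_nonneg_pos)
    ultimately show "f (fst x) (snd x) =
        \<sigma>\<^sup>2 / (2 * pi)\<^sup>2 * ((norm (fst x))\<^sup>2 + (C (snd x))\<^sup>2) powr (- (2 * \<nu>))"
      by (simp add: lw powr_minus H_def field_simps)
  qed
qed

section \<open>The cross spectrum\<close>

lemma borel_measurable_Bessel_K [measurable]: "Bessel_K \<mu> \<in> borel_measurable borel"
  unfolding Bessel_K_def[abs_def] set_lebesgue_integral_def by measurable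

text \<open>By Fubini the wave number is integrated out first. The remaining function of w has the
  autocovariances as its Fourier coefficients, and the transform of the inverse power gives it in
  closed form.\<close>

lemma cross_spectrum_of_density:
  fixes f :: "real^2 \<Rightarrow> real \<Rightarrow> real" and C :: "real \<Rightarrow> real"
  assumes f_dens: "spectral_density P Y f" and p: "p > 0" and h: "h \<noteq> 0"
    and C [measurable]: "C \<in> borel_measurable borel" and C_pos: "\<And>w. C w > 0"
    and f_eq: "AE x in freq_space. f (fst x) (snd x) = b * ((norm (fst x))\<^sup>2 + (C (snd x))\<^sup>2) powr (- p)"
    and G: "\<And>w. w \<in> {-pi..pi} \<Longrightarrow> G w = complex_of_real (b * (2 * pi *
      (norm h / (2 * C w)) powr (p - 1) * (Bessel_K (p - 1) (C w * norm h) / Gamma p)))"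
  shows "cross_spectrum P Y h G"
proof -
  let ?D = "UNIV \<times> {-pi..pi} :: ((real^2) \<times> real) set"
  define F where "F l w = indicator {-pi..pi} w * (b * ((norm l)\<^sup>2 + (C w)\<^sup>2) powr (- p))" for l :: "real^2" and w
  define K where "K w = indicator {-pi..pi} w *\<^sub>R complex_of_real (b * (2 * pi *
      (norm h / (2 * C w)) powr (p - 1) * (Bessel_K (p - 1) (C w * norm h) / Gamma p)))" for w
  have K_eq: "indicator {-pi..pi} w *\<^sub>R G w = K w" for w
    by (auto simp: K_def G split: split_indicator)
  have [measurable]: "K \<in> borel_measurable borel"
    unfolding K_def[abs_def] by measurable
  have [measurable]: "(\<lambda>(l, w). F l w) \<in> borel_measurable (lborel \<Otimes>\<^sub>M lborel)"
    unfolding F_def[abs_def] by measurable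
  have D: "?D \<inter> space (lborel \<Otimes>\<^sub>M lborel) \<in> sets (lborel \<Otimes>\<^sub>M lborel)"
    by (simp add: space_pair_measure)
  \<comment> \<open>Extension by zero from the slab to the full product, where Fubini's theorem for
    \<open>lborel\<close> is available.\<close>
  define f' where "f' x = indicator ?D x * f (fst x) (snd x)" for x
  have F_ae: "AE x in lborel \<Otimes>\<^sub>M lborel. f' x = F (fst x) (snd x)"
    using f_eq unfolding freq_space_alt AE_restrict_space_iff[OF D]
    by eventually_elim (auto simp: F_def f'_def split: split_indicator)
  have f_int: "integrable (lborel \<Otimes>\<^sub>M lborel) f'"
    using f_dens unfolding spectral_density_def freq_space_alt integrable_restrict_space[OF D]
    by (simp add: case_prod_unfold f'_def[abs_def])
  then have [measurable]: "f' \<in> borel_measurable (lborel \<Otimes>\<^sub>M lborel)"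
    by (rule borel_measurable_integrable)
  have F_int: "integrable (lborel \<Otimes>\<^sub>M lborel) (\<lambda>(l, w). F l w)"
    using f_int by (rule integrable_cong_AE_imp) (use F_ae in \<open>auto simp: case_prod_unfold\<close>)
  have char_int: "integrable (lborel \<Otimes>\<^sub>M lborel) (\<lambda>(l, w). cis (h \<bullet> l + r * w) * complex_of_real (F l w))" for r
    by (rule Bochner_Integration.integrable_bound[OF F_int]) (auto simp: norm_mult case_prod_unfold)
  have acov: "autocov P Y h u =
      (\<integral>x. cis (h \<bullet> fst x + of_int u * snd x) * complex_of_real (F (fst x) (snd x)) \<partial>(lborel \<Otimes>\<^sub>M lborel))" for u
  proof -
    have "autocov P Y h u = (\<integral>x. cis (h \<bullet> fst x + of_int u * snd x) *
        complex_of_real (f' x) \<partial>(lborel \<Otimes>\<^sub>M lborel))"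
      using f_dens unfolding spectral_density_def freq_space_alt integral_restrict_space[OF D]
      by (simp add: case_prod_unfold f'_def scaleR_conv_of_real mult_ac)
    also have "\<dots> = (\<integral>x. cis (h \<bullet> fst x + of_int u * snd x) * complex_of_real (F (fst x) (snd x)) \<partial>(lborel \<Otimes>\<^sub>M lborel))"
      using F_ae by (intro integral_cong_AE) auto
    finally show ?thesis .
  qed
  have inner: "AE w in lborel. (\<integral>l. cis (h \<bullet> l) * complex_of_real (F l w) \<partial>lborel) = K w"
    using lborel_pair.AE_integrable_snd[of F, OF F_int]
  proof eventually_elim
    case (elim w)
    show ?case
    \<comment> \<open>For b = 0, integrability of \<open>F\<close> says nothing about the inverse
      power, but then both sides are zero. Otherwise the factor b can be divided out of the
      integrable section of \<open>F\<close>.\<close>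
    proof (cases "w \<in> {-pi..pi} \<and> b \<noteq> 0")
      case True
      then have "integrable lborel (\<lambda>l::real^2. ((norm l)\<^sup>2 + (C w)\<^sup>2) powr (- p))"
        using elim by (simp add: F_def)
      from fourier_transform_inverse_power[OF p C_pos h this]
      have "(\<integral>l. complex_of_real b * (cis (h \<bullet> l) * complex_of_real (((norm l)\<^sup>2 + (C w)\<^sup>2) powr (- p))) \<partial>lborel) = K w"
        using True by (simp only: integral_mult_right_zero) (simp add: K_def)
      then show ?thesis using True by (simp add: F_def mult_ac)
    qed (auto simp: F_def K_def split: split_indicator)
  qed
  \<comment> \<open>Integrability of the Bessel expression comes from Fubini, without estimates of
    \<open>Bessel_K\<close>.\<close>
  have K_int: "integrable lborel K"
  proof (rule integrable_cong_AE_imp[rotated, OF _ inner])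
    show "integrable lborel (\<lambda>w. \<integral>l. cis (h \<bullet> l) * complex_of_real (F l w) \<partial>lborel)"
      using lborel_pair.integrable_snd[of "\<lambda>l w. cis (h \<bullet> l) * complex_of_real (F l w)"] char_int[of 0] by simp
  qed measurable
  have "autocov P Y h u = (\<integral>w. cis (of_int u * w) * K w \<partial>lborel)" for u
  proof -
    have "autocov P Y h u = (\<integral>w. \<integral>l. cis (h \<bullet> l + of_int u * w) * complex_of_real (F l w) \<partial>lborel \<partial>lborel)"
      using lborel_pair.integral_snd[of "\<lambda>l w. cis (h \<bullet> l + of_int u * w) * complex_of_real (F l w)"] char_int[of "of_int u"]
      by (simp add: acov case_prod_unfold)
    also have "\<dots> = (\<integral>w. cis (of_int u * w) * (\<integral>l. cis (h \<bullet> l) * complex_of_real (F l w) \<partial>lborel) \<partial>lborel)"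
      by (simp add: cis_mult[symmetric] mult_ac flip: integral_mult_right_zero)
    also have "\<dots> = (\<integral>w. cis (of_int u * w) * K w \<partial>lborel)"
      by (rule integral_cong_AE) (use inner in auto)
    finally show ?thesis .
  qed
  then show ?thesis
    using K_int by (simp add: cross_spectrum_def set_integrable_def set_lebesgue_integral_def K_eq mult_scaleR_right[symmetric] del: mult_scaleR_right)
qed

text \<open>The difference, cut off outside the frequency interval, has all Fourier coefficients
  zero.\<close>

lemma cross_spectrum_unique:
  assumes g: "cross_spectrum P Y h g" and G: "cross_spectrum P Y h G"
  shows "AE w in lborel. w \<in> {-pi..pi} \<longrightarrow> g w = G w"
proof -
  let ?i = "\<lambda>g w. indicator {-pi..pi} w *\<^sub>R g w :: complex"
  have int: "integrable lborel (?i g)" "integrable lborel (?i G)"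
    using g G by (auto simp: cross_spectrum_def set_integrable_def)
  have coeff: "(\<integral>w. cis (of_int u * w) * ?i g w \<partial>lborel) = (\<integral>w. cis (of_int u * w) * ?i G w \<partial>lborel)" for u :: int
    using g G by (simp add: cross_spectrum_def set_lebesgue_integral_def)
  have cis_int: "integrable lborel (\<lambda>w. cis (r * w) * ?i g w)" "integrable lborel (\<lambda>w. cis (r * w) * ?i G w)" for r
    by (rule integrable_bounded_mult[OF int(1), where B = 1]; simp)
      (rule integrable_bounded_mult[OF int(2), where B = 1]; simp)
  have "fourier_null (\<lambda>w. ?i g w - ?i G w)"
    unfolding fourier_null_def using int coeff cis_int by (simp only: right_diff_distrib) simp
  then have "AE w in lborel. ?i g w - ?i G w = 0"
    by (rule fourier_null_imp_AE_zero) simp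
  then show ?thesis by eventually_elim auto
qed

theorem theorem1:
  fixes P :: "'w measure"
    and Y :: "int \<Rightarrow> real^2 \<Rightarrow> 'w \<Rightarrow> complex"
    and f :: "real^2 \<Rightarrow> real \<Rightarrow> real"
    and Z\<^sub>Y Z\<^sub>e :: "((real^2) \<times> real) set \<Rightarrow> 'w \<Rightarrow> complex"
    and c :: "real \<Rightarrow> complex"
    and \<nu> \<sigma> :: real and n :: nat and k :: int
  assumes "prob_space P"
    and "\<nu> > 0" and "n \<ge> 1"
    and "zero_mean_stationary P Y"
    and "spectral_density P Y f"
    and "spectral_representation P Y f Z\<^sub>Y"
    and "white_noise_increments P \<sigma> Z\<^sub>e"
    and "c \<in> borel_measurable (restrict_space borel {-pi..pi})"
    and "\<forall>w\<in>{-pi..pi}. cmod (c w) > 0"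
    and "satisfies_dft_equation P f Z\<^sub>Y \<sigma> Z\<^sub>e n k \<nu> c"
  shows "(AE (l, w) in freq_space.
            f l w = \<sigma>\<^sup>2 / ((2 * pi)\<^sup>2 * ((l $ 1)\<^sup>2 + (l $ 2)\<^sup>2 + (cmod (c w))\<^sup>2) powr (2 * \<nu>))) \<and>
         (isotropic P Y \<longrightarrow>
            (\<forall>h. h \<noteq> 0 \<longrightarrow>
               (let G = (\<lambda>w. complex_of_real
                      (\<sigma>\<^sup>2 / (2 * pi) * (norm h / (2 * cmod (c w))) powr (2 * \<nu> - 1) *
                       (Bessel_K (2 * \<nu> - 1) (cmod (c w) * norm h) / Gamma (2 * \<nu>))))
                in cross_spectrum P Y h G \<and>
                   (\<forall>g. cross_spectrum P Y h g \<longrightarrow> (AE w in lborel. w \<in> {-pi..pi} \<longrightarrow> g w = G w)))))"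
proof -
  \<comment> \<open>\<open>c\<close> is measurable and nonzero only on \<open>{-pi..pi}\<close>.\<close>
  define C where "C w = (if w \<in> {-pi..pi} then cmod (c w) else 1)" for w
  have C_meas: "C \<in> borel_measurable borel"
    unfolding C_def[abs_def]
  proof (subst measurable_If_restrict_space_iff)
    show "(\<lambda>w. cmod (c w)) \<in> borel_measurable (restrict_space borel {w. w \<in> {-pi..pi}}) \<and>
        (\<lambda>w. 1 :: real) \<in> borel_measurable (restrict_space borel {w. w \<notin> {-pi..pi}})"
      using measurable_compose[OF assms(8) borel_measurable_norm] by (simp only: Collect_mem_eq) simp
  qed simp
  have C_eq: "C w = cmod (c w)" if "w \<in> {-pi..pi}" for w
    using that by (simp add: C_def)
  have C_pos: "C w > 0" for w
    using assms(9) by (simp add: C_def)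
  have f_eq: "AE x in freq_space. f (fst x) (snd x) =
      \<sigma>\<^sup>2 / (2 * pi)\<^sup>2 * ((norm (fst x))\<^sup>2 + (C (snd x))\<^sup>2) powr (- (2 * \<nu>))"
    using assms(5,6,7,3,10) C_meas C_eq C_pos unfolding spectral_representation_def white_noise_increments_def
    by (intro spectral_density_eq) auto
  have density: "AE (l, w) in freq_space.
      f l w = \<sigma>\<^sup>2 / ((2 * pi)\<^sup>2 * ((l $ 1)\<^sup>2 + (l $ 2)\<^sup>2 + (cmod (c w))\<^sup>2) powr (2 * \<nu>))"
    using f_eq
  proof (rule AE_mp, intro AE_I2 impI)
    fix x assume "x \<in> space freq_space" and eq: "f (fst x) (snd x) =
      \<sigma>\<^sup>2 / (2 * pi)\<^sup>2 * ((norm (fst x))\<^sup>2 + (C (snd x))\<^sup>2) powr (- (2 * \<nu>))"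
    then have "C (snd x) = cmod (c (snd x))" by (intro C_eq) (auto simp: space_freq_space)
    with eq show "case x of (l, w) \<Rightarrow>
        f l w = \<sigma>\<^sup>2 / ((2 * pi)\<^sup>2 * ((l $ 1)\<^sup>2 + (l $ 2)\<^sup>2 + (cmod (c w))\<^sup>2) powr (2 * \<nu>))"
      by (simp only: case_prod_unfold norm_square_vec2 powr_minus divide_inverse
          inverse_mult_distrib mult.assoc)
  qed
  define G where "G h w = complex_of_real
      (\<sigma>\<^sup>2 / (2 * pi) * (norm h / (2 * cmod (c w))) powr (2 * \<nu> - 1) *
       (Bessel_K (2 * \<nu> - 1) (cmod (c w) * norm h) / Gamma (2 * \<nu>)))" for h :: "real^2" and w
  have G: "cross_spectrum P Y h (G h)" if "h \<noteq> 0" for h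
  proof (rule cross_spectrum_of_density[OF assms(5) _ that C_meas C_pos f_eq])
    show "2 * \<nu> > 0" using assms(2) by simp
    fix w assume "w \<in> {-pi..pi}"
    \<comment> \<open>The factor \<open>2 * pi\<close> from the planar Fourier transform cancels one
      of the two in \<open>(2 * pi)\<^sup>2\<close>.\<close>
    then show "G h w = complex_of_real (\<sigma>\<^sup>2 / (2 * pi)\<^sup>2 * (2 * pi *
        (norm h / (2 * C w)) powr (2 * \<nu> - 1) * (Bessel_K (2 * \<nu> - 1) (C w * norm h) / Gamma (2 * \<nu>))))"
      by (simp add: G_def C_eq power2_eq_square)
  qed
  have "\<forall>h. h \<noteq> 0 \<longrightarrow> (cross_spectrum P Y h (G h) \<and>
      (\<forall>g. cross_spectrum P Y h g \<longrightarrow> (AE w in lborel. w \<in> {-pi..pi} \<longrightarrow> g w = G h w)))"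
    using G cross_spectrum_unique by blast
  with density show ?thesis
    unfolding Let_def G_def by blast
qed

end
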